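(* Let $T_\Lambda=\mathbb R^g/\Lambda$ be a polarized real torus of dimension $g$, where $\Lambda$ is a lattice in $\mathbb R^g$, let $H_\Lambda$ be the associated positive definite hermitian form on $\mathbb C^g$, and let $B_\Lambda$ and $\alpha_\Lambda$ be as defined in the context. Define $$I_{B_\Lambda,\alpha_\Lambda}:\Lambda\times\mathbb R^g\to\mathbb C^*,\qquad I_{B_\Lambda,\alpha_\Lambda}(\lambda,v)=\alpha_\Lambda(2\,i\,\lambda)\,e^{\pi B_\Lambda(\lambda,\lambda)+2\pi B_\Lambda(v,\lambda)}.$$ Then $\lambda\cdot(v,\eta)=\big(v+\lambda,\ I_{B_\Lambda,\alpha_\Lambda}(\lambda,v)\,\eta\big)$, for $\lambda\in\Lambda$, $v\in\mathbb R^g$, $\eta\in\mathbb C$, is a free action of $\Lambda$ on the trivial line bundle $\mathbb R^g\times\mathbb C$, and the quotient $$L(B_\Lambda,\alpha_\Lambda)=(\mathbb R^g\times\mathbb C)/\Lambda$$ is a smooth (complex) line bundle over $T_\Lambda$.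
   Context: A real torus $T_\Lambda=\mathbb R^g/\Lambda$ is called polarized if the associated complex torus $\mathfrak A_\Lambda=\mathbb C^g/L_\Lambda$, $L_\Lambda=\mathbb Z^g+i\Lambda$, with real structure $S$ induced by complex conjugation, is a polarized real abelian variety. This means that there is a positive definite hermitian form $H_\Lambda$ on $\mathbb C^g$ whose imaginary part $E_\Lambda=\mathrm{Im}\,H_\Lambda$ is integer valued on $L_\Lambda\times L_\Lambda$ and satisfies $E_\Lambda(\overline a,\overline b)=-E_\Lambda(a,b)$; such an $H_\Lambda$ is fixed as part of the data. Write $H_\Lambda=S_\Lambda+i\,E_\Lambda$ with $S_\Lambda$ the real part and $E_\Lambda$ the imaginary part, so that $S_\Lambda$ is real symmetric bilinear and $E_\Lambda$ is real alternating. $B_\Lambda$ denotes the restriction of $S_\Lambda$ to $\mathbb R^g\times\mathbb R^g$. The canonical map $\alpha_\Lambda:L_\Lambda\to\{z\in\mathbb C: |z|=1\}$ is defined by $\alpha_\Lambda(\kappa+i\lambda)=e^{\pi i\,E_\Lambda(\kappa,\,i\lambda)}$ for $\kappa\in\mathbb Z^g$, $\lambda\in\Lambda$. *)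

theory Defs
  imports "HOL-Analysis.Analysis" "HOL-Algebra.Group_Action" "HOL-Algebra.Module"
begin

section \<open>Smooth maps and smooth manifolds\<close>

text \<open>
  Only used for open \<open>S\<close>, where \<open>at x\<close> and \<open>at x within S\<close> agree.
  In finite dimensions, continuity of the iterated directional derivatives \<open>x \<mapsto> Df(x) v\<close> for each
  fixed \<open>v\<close> is the same as continuity of the iterated derivatives in operator norm.
\<close>

primrec Ck_on :: "nat \<Rightarrow> ('a::real_normed_vector \<Rightarrow> 'b::real_normed_vector) \<Rightarrow> 'a set \<Rightarrow> bool" where
  "Ck_on 0 f S \<longleftrightarrow> continuous_on S f"
| "Ck_on (Suc k) f S \<longleftrightarrow>
     (\<forall>x\<in>S. f differentiable (at x)) \<and> (\<forall>v. Ck_on k (\<lambda>x. frechet_derivative f (at x) v) S)"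

definition smooth_on :: "('a::real_normed_vector \<Rightarrow> 'b::real_normed_vector) \<Rightarrow> 'a set \<Rightarrow> bool" where
  "smooth_on f S \<longleftrightarrow> (\<forall>k. Ck_on k f S)"

text \<open>
  A chart is a pair \<open>(U, \<phi>)\<close> of a domain and a map that is only relevant on \<open>U\<close>. Atlases are not
  required to be maximal; none of the notions below changes when an atlas is replaced by a
  compatible one.
\<close>

record ('m, 'e) manifold_data =
  mtop :: "'m topology"
  matlas :: "('m set \<times> ('m \<Rightarrow> 'e)) set"

abbreviation points :: "('m, 'e) manifold_data \<Rightarrow> 'm set" where
  "points M \<equiv> topspace (mtop M)"

definition smooth_manifold :: "('m, 'e::euclidean_space) manifold_data \<Rightarrow> bool" where
  "smooth_manifold M \<longleftrightarrow>
     Hausdorff_space (mtop M) \<and> second_countable (mtop M) \<and>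
     (\<forall>(U, \<phi>) \<in> matlas M. openin (mtop M) U \<and> open (\<phi> ` U) \<and>
        homeomorphic_map (subtopology (mtop M) U) (top_of_set (\<phi> ` U)) \<phi>) \<and>
     (\<Union>(U, \<phi>) \<in> matlas M. U) = points M \<and>
     (\<forall>(U, \<phi>) \<in> matlas M. \<forall>(V, \<psi>) \<in> matlas M.
        smooth_on (\<psi> \<circ> inv_into U \<phi>) (\<phi> ` (U \<inter> V)))"

definition smooth_map ::
  "('m, 'e::euclidean_space) manifold_data \<Rightarrow> ('n, 'f::euclidean_space) manifold_data
    \<Rightarrow> ('m \<Rightarrow> 'n) \<Rightarrow> bool" where
  "smooth_map M N f \<longleftrightarrow>
     continuous_map (mtop M) (mtop N) f \<and>
     (\<forall>(U, \<phi>) \<in> matlas M. \<forall>(V, \<psi>) \<in> matlas N.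
        smooth_on (\<psi> \<circ> f \<circ> inv_into U \<phi>) (\<phi> ` (U \<inter> f -` V)))"

definition diffeomorphism ::
  "('m, 'e::euclidean_space) manifold_data \<Rightarrow> ('n, 'f::euclidean_space) manifold_data
    \<Rightarrow> ('m \<Rightarrow> 'n) \<Rightarrow> bool" where
  "diffeomorphism M N f \<longleftrightarrow>
     smooth_map M N f \<and>
     (\<exists>g. smooth_map N M g \<and> (\<forall>x\<in>points M. g (f x) = x) \<and> (\<forall>y\<in>points N. f (g y) = y))"

definition euclidean_manifold :: "('e::euclidean_space, 'e) manifold_data" where
  "euclidean_manifold = \<lparr>mtop = euclidean, matlas = {(UNIV, id)}\<rparr>"

definition open_submanifold :: "('m, 'e) manifold_data \<Rightarrow> 'm set \<Rightarrow> ('m, 'e) manifold_data" where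
  "open_submanifold M W =
     \<lparr>mtop = subtopology (mtop M) W, matlas = {(U \<inter> W, \<phi>) | U \<phi>. (U, \<phi>) \<in> matlas M}\<rparr>"

definition product_manifold ::
  "('m, 'e) manifold_data \<Rightarrow> ('n, 'f) manifold_data \<Rightarrow> ('m \<times> 'n, 'e \<times> 'f) manifold_data" where
  "product_manifold M N =
     \<lparr>mtop = prod_topology (mtop M) (mtop N),
      matlas = {(U \<times> V, map_prod \<phi> \<psi>) | U \<phi> V \<psi>. (U, \<phi>) \<in> matlas M \<and> (V, \<psi>) \<in> matlas N}\<rparr>"


section \<open>Smooth complex line bundles\<close>

definition complex_field :: "complex ring" where
  "complex_field = \<lparr>carrier = UNIV, mult = (*), one = 1, zero = 0, add = (+)\<rparr>"

definition one_dimensional :: "(complex, 'v) module \<Rightarrow> bool" where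
  "one_dimensional V \<longleftrightarrow> (\<exists>e\<in>carrier V. \<forall>x\<in>carrier V. \<exists>!c. x = c \<odot>\<^bsub>V\<^esub> e)"

text \<open>
  The total space \<open>L\<close>, the base \<open>M\<close>, the projection \<open>p\<close>, and for every base point \<open>b\<close> the vector
  space structure \<open>F b\<close> on the fibre over \<open>b\<close>. The map \<open>h\<close> is the second component of a local
  trivialization over \<open>U\<close>.
\<close>

definition smooth_complex_line_bundle ::
  "('l, 'e::euclidean_space) manifold_data \<Rightarrow> ('m, 'f::euclidean_space) manifold_data
    \<Rightarrow> ('l \<Rightarrow> 'm) \<Rightarrow> ('m \<Rightarrow> (complex, 'l) module) \<Rightarrow> bool" where
  "smooth_complex_line_bundle L M p F \<longleftrightarrow>
     smooth_manifold L \<and> smooth_manifold M \<and> smooth_map L M p \<and>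
     (\<forall>b\<in>points M. carrier (F b) = {x \<in> points L. p x = b} \<and>
        module complex_field (F b) \<and> one_dimensional (F b)) \<and>
     (\<forall>b\<in>points M. \<exists>U h. openin (mtop M) U \<and> b \<in> U \<and>
        diffeomorphism (open_submanifold L {x \<in> points L. p x \<in> U})
          (product_manifold (open_submanifold M U) (euclidean_manifold :: (complex, complex) manifold_data))
          (\<lambda>x. (p x, h x)) \<and>
        (\<forall>c\<in>U. \<forall>x\<in>carrier (F c). \<forall>y\<in>carrier (F c). h (x \<oplus>\<^bsub>F c\<^esub> y) = h x + h y) \<and>
        (\<forall>c\<in>U. \<forall>x\<in>carrier (F c). \<forall>k. h (k \<odot>\<^bsub>F c\<^esub> x) = k * h x))"

definition trivial_line_bundle_automorphism ::
  "('v::euclidean_space \<times> complex \<Rightarrow> 'v \<times> complex) \<Rightarrow> bool" where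
  "trivial_line_bundle_automorphism f \<longleftrightarrow>
     diffeomorphism euclidean_manifold euclidean_manifold f \<and>
     (\<exists>s. \<forall>v. \<exists>c. c \<noteq> 0 \<and> (\<forall>\<eta>. f (v, \<eta>) = (s v, c * \<eta>)))"


section \<open>Free actions and quotients\<close>

definition free_action :: "('a, 'b) monoid_scheme \<Rightarrow> 'x set \<Rightarrow> ('a \<Rightarrow> 'x \<Rightarrow> 'x) \<Rightarrow> bool" where
  "free_action G X \<phi> \<longleftrightarrow>
     group_action G X \<phi> \<and> (\<forall>x\<in>X. stabilizer G \<phi> x = {\<one>\<^bsub>G\<^esub>})"

definition quotient_topology ::
  "('a, 'b) monoid_scheme \<Rightarrow> ('a \<Rightarrow> 'v \<Rightarrow> 'v) \<Rightarrow> 'v::topological_space set topology" where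
  "quotient_topology G \<phi> = topology (\<lambda>U. U \<subseteq> orbits G UNIV \<phi> \<and> open {x. orbit G \<phi> x \<in> U})"

lemma openin_quotient_topology:
  "openin (quotient_topology G \<phi>) U \<longleftrightarrow> U \<subseteq> orbits G UNIV \<phi> \<and> open {x. orbit G \<phi> x \<in> U}"
proof -
  have "istopology (\<lambda>U. U \<subseteq> orbits G UNIV \<phi> \<and> open {x. orbit G \<phi> x \<in> U})"
  proof -
    have "{x. orbit G \<phi> x \<in> \<Union>K} = (\<Union>U\<in>K. {x. orbit G \<phi> x \<in> U})" for K
      by auto
    then show ?thesis
      unfolding istopology_def by (auto simp: Collect_conj_eq open_Int)
  qed
  then show ?thesis
    by (simp add: quotient_topology_def topology_inverse')
qed

text \<open>
  The charts of the quotient are the local inverses of the quotient map \<open>x \<mapsto> orbit G \<phi> x\<close>: this is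
  the smooth structure for which the quotient map is a local diffeomorphism. It is an atlas
  only if the action is well behaved; this is not assumed here but is part of
  \<open>smooth_manifold (quotient_manifold G \<phi>)\<close>.
\<close>

definition quotient_manifold ::
  "('a, 'b) monoid_scheme \<Rightarrow> ('a \<Rightarrow> 'v \<Rightarrow> 'v) \<Rightarrow> ('v::euclidean_space set, 'v) manifold_data" where
  "quotient_manifold G \<phi> =
     \<lparr>mtop = quotient_topology G \<phi>,
      matlas = {(orbit G \<phi> ` W, inv_into W (orbit G \<phi>)) | W. open W \<and> inj_on (orbit G \<phi>) W}\<rparr>"


section \<open>Polarized real tori\<close>

definition is_lattice :: "'v::euclidean_space set \<Rightarrow> bool" where
  "is_lattice \<Lambda> \<longleftrightarrow>
     (\<exists>B. independent B \<and> span B = UNIV \<and> \<Lambda> = range (\<lambda>n :: 'v \<Rightarrow> int. \<Sum>b\<in>B. of_int (n b) *\<^sub>R b))"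

definition cvec :: "real ^ 'g \<Rightarrow> complex ^ 'g" where
  "cvec v = (\<chi> j. complex_of_real (v $ j))"

definition Re_vec :: "complex ^ 'g \<Rightarrow> real ^ 'g" where
  "Re_vec z = (\<chi> j. Re (z $ j))"

definition Im_vec :: "complex ^ 'g \<Rightarrow> real ^ 'g" where
  "Im_vec z = (\<chi> j. Im (z $ j))"

definition cnj_vec :: "complex ^ 'g \<Rightarrow> complex ^ 'g" where
  "cnj_vec z = (\<chi> j. cnj (z $ j))"

definition complex_lattice :: "(real ^ 'g) set \<Rightarrow> (complex ^ 'g) set" where
  "complex_lattice \<Lambda> = {cvec \<kappa> + \<i> *s cvec l | \<kappa> l. (\<forall>j. \<kappa> $ j \<in> \<int>) \<and> l \<in> \<Lambda>}"

definition positive_definite_hermitian ::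
  "(complex ^ 'g \<Rightarrow> complex ^ 'g \<Rightarrow> complex) \<Rightarrow> bool" where
  "positive_definite_hermitian H \<longleftrightarrow>
     (\<forall>x y z. H (x + y) z = H x z + H y z) \<and>
     (\<forall>c x y. H (c *s x) y = c * H x y) \<and>
     (\<forall>x y. H y x = cnj (H x y)) \<and>
     (\<forall>x. x \<noteq> 0 \<longrightarrow> Re (H x x) > 0)"

text \<open>\<open>\<Lambda>\<close> is a lattice and \<open>H\<close> is the hermitian form polarizing the torus \<open>\<real>\<^sup>g/\<Lambda>\<close>.\<close>

definition polarized_real_torus ::
  "(real ^ 'g) set \<Rightarrow> (complex ^ 'g \<Rightarrow> complex ^ 'g \<Rightarrow> complex) \<Rightarrow> bool" where
  "polarized_real_torus \<Lambda> H \<longleftrightarrow>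
     is_lattice \<Lambda> \<and> positive_definite_hermitian H \<and>
     (\<forall>a\<in>complex_lattice \<Lambda>. \<forall>b\<in>complex_lattice \<Lambda>. Im (H a b) \<in> \<int>) \<and>
     (\<forall>a b. Im (H (cnj_vec a) (cnj_vec b)) = - Im (H a b))"

definition B_form :: "(complex ^ 'g \<Rightarrow> complex ^ 'g \<Rightarrow> complex) \<Rightarrow> real ^ 'g \<Rightarrow> real ^ 'g \<Rightarrow> real" where
  "B_form H v w = Re (H (cvec v) (cvec w))"

text \<open>
  For \<open>z = \<kappa> + \<i> l\<close> in the complex lattice, \<open>\<kappa>\<close> and \<open>l\<close> are the real and imaginary parts
  of \<open>z\<close>. Values outside the complex lattice are irrelevant.
\<close>

definition canonical_map ::
  "(complex ^ 'g \<Rightarrow> complex ^ 'g \<Rightarrow> complex) \<Rightarrow> complex ^ 'g \<Rightarrow> complex" where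
  "canonical_map H z =
     exp (of_real pi * \<i> * of_real (Im (H (cvec (Re_vec z)) (\<i> *s cvec (Im_vec z)))))"

definition I_factor ::
  "(real ^ 'g \<Rightarrow> real ^ 'g \<Rightarrow> real) \<Rightarrow> (complex ^ 'g \<Rightarrow> complex) \<Rightarrow> real ^ 'g \<Rightarrow> real ^ 'g \<Rightarrow> complex" where
  "I_factor B \<alpha> l v = \<alpha> ((2 * \<i>) *s cvec l) * of_real (exp (pi * B l l + 2 * pi * B v l))"

definition lattice_group :: "'v::ab_group_add set \<Rightarrow> 'v monoid" where
  "lattice_group \<Lambda> = \<lparr>carrier = \<Lambda>, mult = (+), one = 0\<rparr>"

definition translation :: "real ^ 'g \<Rightarrow> real ^ 'g \<Rightarrow> real ^ 'g" where
  "translation l v = v + l"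

definition bundle_action ::
  "(real ^ 'g \<Rightarrow> real ^ 'g \<Rightarrow> real) \<Rightarrow> (complex ^ 'g \<Rightarrow> complex)
    \<Rightarrow> real ^ 'g \<Rightarrow> (real ^ 'g) \<times> complex \<Rightarrow> (real ^ 'g) \<times> complex" where
  "bundle_action B \<alpha> l = (\<lambda>(v, \<eta>). (v + l, I_factor B \<alpha> l v * \<eta>))"

definition real_torus :: "(real ^ 'g) set \<Rightarrow> ((real ^ 'g) set, real ^ 'g) manifold_data" where
  "real_torus \<Lambda> = quotient_manifold (lattice_group \<Lambda>) translation"

definition total_space ::
  "(real ^ 'g) set \<Rightarrow> (real ^ 'g \<Rightarrow> real ^ 'g \<Rightarrow> real) \<Rightarrow> (complex ^ 'g \<Rightarrow> complex)
    \<Rightarrow> (((real ^ 'g) \<times> complex) set, (real ^ 'g) \<times> complex) manifold_data" where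
  "total_space \<Lambda> B \<alpha> = quotient_manifold (lattice_group \<Lambda>) (bundle_action B \<alpha>)"

text \<open>
  Points of the torus and of the total space are orbits, i.e. sets. The first components of the
  orbit \<open>[v, \<eta>]\<close> form the coset \<open>v + \<Lambda>\<close>, so the image under \<open>fst\<close> is the projection
  \<open>[v, \<eta>] \<mapsto> [v]\<close>.
\<close>

definition bundle_projection :: "((real ^ 'g) \<times> complex) set \<Rightarrow> (real ^ 'g) set" where
  "bundle_projection x = fst ` x"

text \<open>
  The vector space structure \<open>[v, \<eta>] + [v, \<eta>'] = [v, \<eta> + \<eta>']\<close>, \<open>k [v, \<eta>] = [v, k \<eta>]\<close> on the fibre
  over \<open>b = v + \<Lambda>\<close>. An orbit over \<open>b\<close> is the graph of a function \<open>b \<rightarrow> \<complex>\<close>, and these operations are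
  the pointwise ones. The fields \<open>mult\<close> and \<open>one\<close> of the record are not used by \<open>module\<close>.
\<close>

definition bundle_fibre ::
  "(real ^ 'g) set \<Rightarrow> (real ^ 'g \<Rightarrow> real ^ 'g \<Rightarrow> real) \<Rightarrow> (complex ^ 'g \<Rightarrow> complex)
    \<Rightarrow> (real ^ 'g) set \<Rightarrow> (complex, ((real ^ 'g) \<times> complex) set) module" where
  "bundle_fibre \<Lambda> B \<alpha> b =
     \<lparr>carrier = {x \<in> points (total_space \<Lambda> B \<alpha>). bundle_projection x = b},
      mult = undefined, one = undefined,
      zero = b \<times> {0},
      add = (\<lambda>x y. {(v, \<eta> + \<eta>') | v \<eta> \<eta>'. (v, \<eta>) \<in> x \<and> (v, \<eta>') \<in> y}),
      smult = (\<lambda>k x. {(v, k * \<eta>) | v \<eta>. (v, \<eta>) \<in> x})\<rparr>"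

end

theory Submission
  imports Defs
begin

text \<open>
  For \<open>\<lambda> \<in> \<Lambda>\<close> the vector \<open>2\<i>\<lambda>\<close> has real part \<open>0\<close>, so \<open>\<alpha>(2\<i>\<lambda>) = 1\<close> and
  \<open>I(\<lambda>, v) = w(v + \<lambda>) / w(v)\<close> with \<open>w(v) = exp (\<pi> B(v, v))\<close>. The map \<open>(v, \<eta>) \<mapsto> (v, \<eta> / w(v))\<close>
  therefore turns the given action into translation in the first factor alone, and the quotient is
  diffeomorphic to \<open>\<real>\<^sup>g/\<Lambda> \<times> \<complex>\<close> by a single global trivialization, which is linear on the fibres.
\<close>

section \<open>Calculus of smooth maps\<close>

text \<open>The obstacle is analytic: the charts of the quotients are local inverses of the orbit
  maps obtained by choice, and smoothness must be tested against all of them. Coordinate expressions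
  are therefore never computed one by one. A map between quotients is lifted to the Euclidean spaces
  above, its smoothness is proved there from an explicit formula, and an element of the group
  corrects the sheet on which a chart happens to live. Only two properties of the quotients need the
  lattice itself: the orbit map of the torus is locally injective because \<Lambda> is discrete, and
  the torus is Hausdorff because \<Lambda> is closed. Both pass to the total space through the
  trivialization.\<close>

lemma Ck_on_subset: "Ck_on k f S \<Longrightarrow> T \<subseteq> S \<Longrightarrow> Ck_on k f T"
  by (induction k arbitrary: f) (auto intro: continuous_on_subset)

text \<open>On an open set, equality of functions passes to their derivatives at each point, so the
  induction can continue with the derivatives.\<close>

lemma Ck_on_cong:
  assumes "open S" "\<And>x. x \<in> S \<Longrightarrow> f x = g x" "Ck_on k f S"
  shows "Ck_on k g S"
  using assms(2,3)
proof (induction k arbitrary: f g)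
  case 0
  then show ?case by (auto cong: continuous_on_cong)
next
  case (Suc k)
  have diff: "g differentiable at x" if x: "x \<in> S" for x
  proof -
    obtain D where "(f has_derivative D) (at x)"
      using Suc.prems(2) x by (auto simp: differentiable_def)
    then have "(g has_derivative D) (at x)"
      by (rule has_derivative_transform_within_open[OF _ \<open>open S\<close> x Suc.prems(1)])
    then show ?thesis by (auto simp: differentiable_def)
  qed
  have eq: "frechet_derivative f (at x) = frechet_derivative g (at x)" if "x \<in> S" for x
    using Suc.prems that \<open>open S\<close> by (intro frechet_derivative_transform_within_open[of f x S]) auto
  have "Ck_on k (\<lambda>x. frechet_derivative g (at x) v) S" for v
    by (rule Suc.IH[of "\<lambda>x. frechet_derivative f (at x) v"]) (use Suc.prems eq in auto)
  with diff show ?case by auto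
qed

text \<open>The product and chain rules keep undifferentiated factors, whose order has to be lowered
  to that of the differentiated ones.\<close>

lemma Ck_on_SucD: "Ck_on (Suc k) f S \<Longrightarrow> Ck_on k f S"
proof (induction k arbitrary: f)
  case 0
  then show ?case
    by (auto simp: differentiable_imp_continuous_within intro!: continuous_at_imp_continuous_on)
next
  case (Suc k)
  then show ?case by (metis Ck_on.simps(2))
qed

text \<open>Uniqueness of the derivative allows any explicit \<open>f'\<close> in place of the
  chosen \<open>frechet_derivative\<close>.\<close>

lemma Ck_on_SucI:
  assumes "open S" "\<And>x. x \<in> S \<Longrightarrow> (f has_derivative f' x) (at x)"
    and "\<And>v. Ck_on k (\<lambda>x. f' x v) S"
  shows "Ck_on (Suc k) f S"
proof -
  have "frechet_derivative f (at x) = f' x" if "x \<in> S" for x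
    using frechet_derivative_at[OF assms(2)[OF that]] by simp
  then have "Ck_on k (\<lambda>x. frechet_derivative f (at x) v) S" for v
    by (intro Ck_on_cong[OF assms(1) _ assms(3)[of v]]) auto
  moreover have "f differentiable at x" if "x \<in> S" for x
    using assms(2)[OF that] by (auto simp: differentiable_def)
  ultimately show ?thesis by simp
qed

lemma Ck_on_SucE:
  assumes "Ck_on (Suc k) f S" "x \<in> S"
  shows "(f has_derivative frechet_derivative f (at x)) (at x)"
  using assms by (auto simp: frechet_derivative_works)

text \<open>\<open>S\<close> is arbitrary here, so chart overlaps can be treated before anything is
  known about their openness. Differentiability at a point does not refer to \<open>S\<close>; only
  the continuity at the bottom of the recursion has to be patched together.\<close>

lemma Ck_on_local:
  assumes "\<And>x. x \<in> S \<Longrightarrow> \<exists>T. open T \<and> x \<in> T \<and> Ck_on k f T"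
  shows "Ck_on k f S"
  using assms
proof (induction k arbitrary: f)
  case 0
  have "isCont f x" if "x \<in> S" for x
    using 0[OF that] by (auto simp: continuous_on_eq_continuous_at)
  then show ?case by (simp add: continuous_at_imp_continuous_on)
next
  case (Suc k)
  have "Ck_on k (\<lambda>x. frechet_derivative f (at x) v) S" for v
    by (rule Suc.IH) (use Suc.prems in fastforce)
  moreover have "f differentiable at x" if "x \<in> S" for x
    using Suc.prems[OF that] by auto
  ultimately show ?case by simp
qed

lemma Ck_on_const: "Ck_on k (\<lambda>x. c) S"
  by (induction k arbitrary: c) auto

lemma Ck_on_bounded_linear:
  assumes "bounded_linear f" "open S"
  shows "Ck_on k f S"
proof (cases k)
  case 0
  then show ?thesis using assms by (simp add: linear_continuous_on)
next
  case (Suc m)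
  show ?thesis unfolding Suc
    by (rule Ck_on_SucI[where f' = "\<lambda>_. f"])
      (use assms in \<open>auto simp: bounded_linear_imp_has_derivative Ck_on_const\<close>)
qed

lemma Ck_on_add:
  assumes "open S" "Ck_on k f S" "Ck_on k g S"
  shows "Ck_on k (\<lambda>x. f x + g x) S"
  using assms(2,3)
proof (induction k arbitrary: f g)
  case 0
  then show ?case by (simp add: continuous_on_add)
next
  case (Suc k)
  show ?case
    by (rule Ck_on_SucI[OF \<open>open S\<close> has_derivative_add[OF Ck_on_SucE[OF Suc.prems(1)] Ck_on_SucE[OF Suc.prems(2)]]])
      (use Suc in auto)
qed

lemma Ck_on_sum:
  assumes "open S" "\<And>i. i \<in> I \<Longrightarrow> Ck_on k (f i) S"
  shows "Ck_on k (\<lambda>x. \<Sum>i\<in>I. f i x) S"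
  using assms(2)
proof (induction I rule: infinite_finite_induct)
  case (insert i I)
  then have "Ck_on k (\<lambda>x. f i x + (\<Sum>j\<in>I. f j x)) S"
    by (intro Ck_on_add[OF assms(1)]) auto
  with insert.hyps show ?case by simp
qed (simp_all add: Ck_on_const)

lemma Ck_on_bounded_bilinear:
  assumes "bounded_bilinear bm" "open S" "Ck_on k f S" "Ck_on k g S"
  shows "Ck_on k (\<lambda>x. bm (f x) (g x)) S"
  using assms(3,4)
proof (induction k arbitrary: f g)
  case 0
  then show ?case using assms(1) by (simp add: bounded_bilinear.continuous_on)
next
  case (Suc k)
  have "Ck_on k (\<lambda>x. bm (f x) (frechet_derivative g (at x) v) + bm (frechet_derivative f (at x) v) (g x)) S" for v
    using Suc.prems
    by (intro Ck_on_add[OF assms(2)] Suc.IH Ck_on_SucD[OF Suc.prems(1)] Ck_on_SucD[OF Suc.prems(2)]) auto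
  then show ?case
    using Ck_on_SucI[OF assms(2) bounded_bilinear.FDERIV[OF assms(1)
        Ck_on_SucE[OF Suc.prems(1)] Ck_on_SucE[OF Suc.prems(2)]]]
    by blast
qed

lemma Ck_on_bounded_linear_compose:
  assumes "bounded_linear L" "open S" "Ck_on k f S"
  shows "Ck_on k (\<lambda>x. L (f x)) S"
  using assms(3)
proof (induction k arbitrary: f)
  case 0
  then show ?case using assms(1) by (auto intro: bounded_linear.continuous_on)
next
  case (Suc k)
  show ?case
    by (rule Ck_on_SucI[OF assms(2) bounded_linear.has_derivative[OF assms(1) Ck_on_SucE[OF Suc.prems(1)]]])
      (use Suc in auto)
qed

text \<open>The chain rule differentiates \<open>g\<close> in the direction \<open>f'(x) v\<close>,
  which varies with \<open>x\<close>, while \<open>Ck_on\<close> controls derivatives in fixed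
  directions only. Expanding this direction in the finite basis of the middle space gives a sum of
  products with fixed directions, and the induction hypothesis applies to each directional
  derivative of \<open>g\<close>.\<close>

lemma Ck_on_compose:
  fixes f :: "'a::real_normed_vector \<Rightarrow> 'b::euclidean_space" and g :: "'b \<Rightarrow> 'c::real_normed_vector"
  assumes "open S" "open T" "Ck_on k f S" "Ck_on k g T" "f ` S \<subseteq> T"
  shows "Ck_on k (\<lambda>x. g (f x)) S"
  using assms(3-)
proof (induction k arbitrary: g)
  case 0
  then show ?case by (auto intro: continuous_on_compose2)
next
  case (Suc k)
  let ?f' = "\<lambda>x. frechet_derivative f (at x)" and ?g' = "\<lambda>y. frechet_derivative g (at y)"
  have der: "((\<lambda>x. g (f x)) has_derivative (\<lambda>v. \<Sum>b\<in>Basis. (?f' x v \<bullet> b) *\<^sub>R ?g' (f x) b)) (at x)"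
    if "x \<in> S" for x
  proof -
    have g: "(g has_derivative ?g' (f x)) (at (f x))"
      using Ck_on_SucE[OF Suc.prems(2)] Suc.prems(3) that by auto
    have "((\<lambda>x. g (f x)) has_derivative (\<lambda>v. ?g' (f x) (?f' x v))) (at x)"
      using has_derivative_compose[OF Ck_on_SucE[OF Suc.prems(1) that] g] .
    moreover have "?g' (f x) w = (\<Sum>b\<in>Basis. (w \<bullet> b) *\<^sub>R ?g' (f x) b)" for w
    proof -
      have lin: "linear (?g' (f x))" using g by (simp add: has_derivative_linear)
      have "?g' (f x) w = ?g' (f x) (\<Sum>b\<in>Basis. (w \<bullet> b) *\<^sub>R b)"
        by (simp add: euclidean_representation)
      also have "\<dots> = (\<Sum>b\<in>Basis. (w \<bullet> b) *\<^sub>R ?g' (f x) b)"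
        by (simp add: linear_sum[OF lin] linear_cmul[OF lin])
      finally show ?thesis .
    qed
    ultimately show ?thesis
      by (rule has_derivative_eq_rhs[OF _ ext])
  qed
  show ?case
  proof (rule Ck_on_SucI[OF assms(1) der])
    fix v
    have "Ck_on k (\<lambda>x. ?g' (f x) b) S" for b
      using Suc.prems(2,3) by (intro Suc.IH[of "\<lambda>y. ?g' y b"] Ck_on_SucD[OF Suc.prems(1)]) auto
    moreover have "Ck_on k (\<lambda>x. ?f' x v \<bullet> b) S" for b
      using Suc.prems(1) by (auto intro: Ck_on_bounded_linear_compose[OF bounded_linear_inner_left assms(1)])
    ultimately show "Ck_on k (\<lambda>x. \<Sum>b\<in>Basis. (?f' x v \<bullet> b) *\<^sub>R ?g' (f x) b) S"
      by (intro Ck_on_sum[OF assms(1)] Ck_on_bounded_bilinear[OF bounded_bilinear_scaleR assms(1)])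
  qed
qed

lemma Ck_on_exp: "open S \<Longrightarrow> Ck_on k (exp :: real \<Rightarrow> real) S"
proof (induction k)
  case 0
  show ?case
    unfolding Ck_on.simps by (intro continuous_at_imp_continuous_on ballI DERIV_isCont[OF DERIV_exp])
next
  case (Suc k)
  show ?case
  proof (rule Ck_on_SucI[where f' = "\<lambda>x. (*) (exp x)"])
    show "Ck_on k (\<lambda>x. exp x * v) S" for v :: real
      by (rule Ck_on_bounded_linear_compose[OF bounded_linear_mult_left Suc.prems Suc.IH[OF Suc.prems]])
  qed (use Suc.prems DERIV_exp in \<open>auto simp: has_field_derivative_def\<close>)
qed

lemma smooth_on_local:
  assumes "\<And>x. x \<in> S \<Longrightarrow> \<exists>T. open T \<and> x \<in> T \<and> smooth_on f T"
  shows "smooth_on f S"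
  unfolding smooth_on_def
proof (intro allI, rule Ck_on_local)
  fix k x assume "x \<in> S"
  then obtain T where "open T" "x \<in> T" "smooth_on f T"
    using assms by blast
  then show "\<exists>T. open T \<and> x \<in> T \<and> Ck_on k f T"
    unfolding smooth_on_def by blast
qed

lemma smooth_on_cong:
  assumes "open S" "\<And>x. x \<in> S \<Longrightarrow> f x = g x" "smooth_on f S"
  shows "smooth_on g S"
  unfolding smooth_on_def
proof
  show "Ck_on k g S" for k
    by (rule Ck_on_cong[OF assms(1,2)]) (use assms(3) in \<open>auto simp: smooth_on_def\<close>)
qed

lemma smooth_on_subset: "smooth_on f S \<Longrightarrow> T \<subseteq> S \<Longrightarrow> smooth_on f T"
  unfolding smooth_on_def by (intro allI Ck_on_subset[of _ f S T]) simp_all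

lemma smooth_on_compose:
  fixes f :: "'a::real_normed_vector \<Rightarrow> 'b::euclidean_space"
  assumes "open S" "open T" "smooth_on f S" "smooth_on g T" "f ` S \<subseteq> T"
  shows "smooth_on (\<lambda>x. g (f x)) S"
  unfolding smooth_on_def
proof
  show "Ck_on k (\<lambda>x. g (f x)) S" for k
    by (rule Ck_on_compose[OF assms(1,2) _ _ assms(5)])
      (use assms(3,4) in \<open>auto simp: smooth_on_def\<close>)
qed

lemma smooth_on_imp_continuous_on: "smooth_on f S \<Longrightarrow> continuous_on S f"
  using Ck_on.simps(1)[of f S] unfolding smooth_on_def by blast

lemma smooth_on_bounded_linear: "bounded_linear f \<Longrightarrow> open S \<Longrightarrow> smooth_on f S"
  by (simp add: smooth_on_def Ck_on_bounded_linear)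

lemma smooth_on_const: "smooth_on (\<lambda>x. c) S"
  by (simp add: smooth_on_def Ck_on_const)

lemma smooth_on_add:
  "open S \<Longrightarrow> smooth_on f S \<Longrightarrow> smooth_on g S \<Longrightarrow> smooth_on (\<lambda>x. f x + g x) S"
  by (simp add: smooth_on_def Ck_on_add)

lemma smooth_on_bounded_bilinear:
  "bounded_bilinear bm \<Longrightarrow> open S \<Longrightarrow> smooth_on f S \<Longrightarrow> smooth_on g S
    \<Longrightarrow> smooth_on (\<lambda>x. bm (f x) (g x)) S"
  by (simp add: smooth_on_def Ck_on_bounded_bilinear)

lemma smooth_on_exp:
  fixes f :: "'a::real_normed_vector \<Rightarrow> real"
  assumes "open S" "smooth_on f S"
  shows "smooth_on (\<lambda>x. exp (f x)) S"
  by (rule smooth_on_compose[OF assms(1) open_UNIV assms(2)]) (auto simp: smooth_on_def Ck_on_exp)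

lemma smooth_on_Pair:
  fixes f :: "'a::real_normed_vector \<Rightarrow> 'b::real_normed_vector" and g :: "'a \<Rightarrow> 'c::real_normed_vector"
  assumes "open S" "smooth_on f S" "smooth_on g S"
  shows "smooth_on (\<lambda>x. (f x, g x)) S"
proof -
  have 1: "bounded_linear (\<lambda>y::'b. (y, 0::'c))"
    by (rule bounded_linear_Pair[OF bounded_linear_ident bounded_linear_zero])
  have 2: "bounded_linear (\<lambda>y::'c. (0::'b, y))"
    by (rule bounded_linear_Pair[OF bounded_linear_zero bounded_linear_ident])
  have "Ck_on k (\<lambda>x. (f x, 0) + (0, g x)) S" for k
  proof (rule Ck_on_add[OF assms(1)])
    show "Ck_on k (\<lambda>x. (f x, 0::'c)) S"
      by (rule Ck_on_bounded_linear_compose[OF 1 assms(1)])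
        (use assms(2) in \<open>simp add: smooth_on_def\<close>)
    show "Ck_on k (\<lambda>x. (0::'b, g x)) S"
      by (rule Ck_on_bounded_linear_compose[OF 2 assms(1)])
        (use assms(3) in \<open>simp add: smooth_on_def\<close>)
  qed
  then show ?thesis by (simp add: smooth_on_def)
qed

section \<open>Manifolds presented as quotients\<close>

text \<open>
  \<open>q\<close> presents \<open>M\<close> as a quotient of a Euclidean space: the charts are local inverses of \<open>q\<close>, and any
  two points of a fibre are related by a globally defined smooth deck transformation \<open>d\<close>. Such
  presentations are stable under products, and a map of manifolds is smooth as soon as it lifts to
  a smooth map of the Euclidean spaces.
\<close>

definition smooth_cover :: "('e::euclidean_space \<Rightarrow> 'm) \<Rightarrow> ('m, 'e) manifold_data \<Rightarrow> bool" where
  "smooth_cover q M \<longleftrightarrow>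
     continuous_map euclidean (mtop M) q \<and> open_map euclidean (mtop M) q \<and> range q = points M \<and>
     (\<forall>(U, \<phi>) \<in> matlas M. \<exists>W. open W \<and> U = q ` W \<and> (\<forall>x\<in>W. \<phi> (q x) = x)) \<and>
     (\<forall>x y. q x = q y \<longrightarrow> (\<exists>d. smooth_on d UNIV \<and> d x = y \<and> (\<forall>z. q (d z) = q z)))"

lemma smooth_coverD:
  assumes "smooth_cover q M"
  shows "continuous_map euclidean (mtop M) q" "open_map euclidean (mtop M) q" "range q = points M"
    and "(U, \<phi>) \<in> matlas M \<Longrightarrow> \<exists>W. open W \<and> U = q ` W \<and> (\<forall>x\<in>W. \<phi> (q x) = x)"
    and "q x = q y \<Longrightarrow> \<exists>d. smooth_on d UNIV \<and> d x = y \<and> (\<forall>z. q (d z) = q z)"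
proof -
  note * = assms[unfolded smooth_cover_def]
  from * show "continuous_map euclidean (mtop M) q" by (elim conjE)
  from * show "open_map euclidean (mtop M) q" by (elim conjE)
  from * show "range q = points M" by (elim conjE)
  from * have "\<forall>(U, \<phi>) \<in> matlas M. \<exists>W. open W \<and> U = q ` W \<and> (\<forall>x\<in>W. \<phi> (q x) = x)"
    by (elim conjE)
  then show "(U, \<phi>) \<in> matlas M \<Longrightarrow> \<exists>W. open W \<and> U = q ` W \<and> (\<forall>x\<in>W. \<phi> (q x) = x)"
    by fast
  from * have "\<forall>x y. q x = q y \<longrightarrow> (\<exists>d. smooth_on d UNIV \<and> d x = y \<and> (\<forall>z. q (d z) = q z))"
    by (elim conjE)
  then show "q x = q y \<Longrightarrow> \<exists>d. smooth_on d UNIV \<and> d x = y \<and> (\<forall>z. q (d z) = q z)"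
    by (elim allE impE)
qed

text \<open>Since \<open>\<phi>\<close> undoes \<open>q\<close> on \<open>W\<close>, it is injective
  on the image of \<open>W\<close>, and the chosen inverse of the chart has to agree with
  \<open>q\<close> on \<open>W\<close>.\<close>

lemma smooth_cover_chart:
  assumes "smooth_cover q M" "(U, \<phi>) \<in> matlas M"
  obtains W where "open W" "U = q ` W" "\<forall>x\<in>W. \<phi> (q x) = x" "\<forall>x\<in>W. inv_into U \<phi> x = q x" "\<phi> ` U = W"
proof -
  obtain W where W: "open W" "U = q ` W" "\<forall>x\<in>W. \<phi> (q x) = x"
    using smooth_coverD(4)[OF assms] by blast
  have "inj_on \<phi> U"
    using W(2,3) by (auto simp: inj_on_def)
  then have "inv_into U \<phi> x = q x" if "x \<in> W" for x
    using W(2,3) that by (intro inv_into_f_eq) auto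
  moreover have "\<phi> ` U = W"
    unfolding W(2) image_image using W(3) by simp
  ultimately show ?thesis
    using W(3) by (intro that[OF W(1,2)]) auto
qed

text \<open>In charts \<open>f\<close> reads as \<open>\<psi>\<close> after \<open>q'\<close> after
  \<open>k\<close>, but \<open>k x\<close> may lie on another sheet than the set \<open>W'\<close>
  on which \<open>\<psi>\<close> inverts \<open>q'\<close>. A deck transformation \<open>d\<close>
  moves \<open>k x\<close> into \<open>W'\<close> without changing its image under
  \<open>q'\<close>, and near \<open>x\<close> the coordinate expression is \<open>d\<close> after
  \<open>k\<close>.\<close>

lemma smooth_cover_transition:
  assumes M: "smooth_cover q M" and N: "smooth_cover q' N"
    and "(U, \<phi>) \<in> matlas M" "(V, \<psi>) \<in> matlas N"
    and k: "smooth_on k UNIV" and fq: "\<And>x. f (q x) = q' (k x)"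
  shows "smooth_on (\<psi> \<circ> f \<circ> inv_into U \<phi>) (\<phi> ` (U \<inter> f -` V))"
proof (rule smooth_on_local)
  obtain W where W: "open W" "U = q ` W" "\<forall>x\<in>W. \<phi> (q x) = x" "\<forall>x\<in>W. inv_into U \<phi> x = q x" "\<phi> ` U = W"
    by (rule smooth_cover_chart[OF M assms(3)])
  obtain W' where W': "open W'" "V = q' ` W'" "\<forall>x\<in>W'. \<psi> (q' x) = x"
    using smooth_coverD(4)[OF N assms(4)] by blast
  fix x assume "x \<in> \<phi> ` (U \<inter> f -` V)"
  then have x: "x \<in> W" "q' (k x) \<in> q' ` W'"
    using W W'(2) by (auto simp: fq)
  then obtain w' where w': "w' \<in> W'" "q' (k x) = q' w'" by blast
  obtain d where d: "smooth_on d UNIV" "d (k x) = w'" "\<And>z. q' (d z) = q' z"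
    using smooth_coverD(5)[OF N w'(2)] by blast
  \<comment> \<open>\<open>d\<close> was chosen for the single point \<open>x\<close>; on
    \<open>T\<close> it still leads into \<open>W'\<close>.\<close>
  define T where "T = W \<inter> (\<lambda>y. d (k y)) -` W'"
  have dk: "smooth_on (\<lambda>y. d (k y)) UNIV"
    by (rule smooth_on_compose[OF open_UNIV open_UNIV k d(1)]) simp
  have "open T"
    unfolding T_def using W(1) W'(1) smooth_on_imp_continuous_on[OF dk]
    by (intro open_Int open_vimage)
  moreover have "x \<in> T"
    using x(1) w'(1) d(2) by (simp add: T_def)
  moreover have "smooth_on (\<psi> \<circ> f \<circ> inv_into U \<phi>) T"
  proof (rule smooth_on_cong[OF \<open>open T\<close>])
    show "smooth_on (\<lambda>y. d (k y)) T"
      by (rule smooth_on_subset[OF dk]) simp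
    fix y assume "y \<in> T"
    then show "d (k y) = (\<psi> \<circ> f \<circ> inv_into U \<phi>) y"
      using W(4) W'(3) d(3)[of "k y"] fq[of y] by (auto simp: T_def)
  qed
  ultimately show "\<exists>T. open T \<and> x \<in> T \<and> smooth_on (\<psi> \<circ> f \<circ> inv_into U \<phi>) T"
    by blast
qed

text \<open>Continuity of \<open>f\<close> follows from that of its lift because \<open>q\<close>,
  being continuous, open and surjective, is a quotient map.\<close>

lemma smooth_map_cover:
  assumes M: "smooth_cover q M" and N: "smooth_cover q' N"
    and k: "smooth_on k UNIV" and fq: "\<And>x. f (q x) = q' (k x)"
  shows "smooth_map M N f"
proof -
  have "quotient_map euclidean (mtop M) q"
    by (rule continuous_open_imp_quotient_map) (use smooth_coverD[OF M] in auto)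
  moreover have "continuous_map euclidean (mtop N) (q' \<circ> k)"
    using smooth_on_imp_continuous_on[OF k] smooth_coverD(1)[OF N]
    by (intro continuous_map_compose[of euclidean euclidean]) auto
  moreover have "f \<circ> q = q' \<circ> k"
    using fq by auto
  ultimately have "continuous_map (mtop M) (mtop N) f"
    using continuous_compose_quotient_map[of euclidean "mtop M" q "mtop N" f] by simp
  then show ?thesis
    unfolding smooth_map_def
    using smooth_cover_transition[where f = f, OF M N _ _ k fq] by blast
qed

lemma second_countable_euclidean: "second_countable (euclidean :: 'a::second_countable_topology topology)"
proof -
  obtain \<B> :: "'a set set" where B: "countable \<B>" "topological_basis \<B>"
    using ex_countable_basis by blast
  have "\<exists>V\<in>\<B>. x \<in> V \<and> V \<subseteq> U" if "open U" "x \<in> U" for U x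
    by (rule topological_basisE[OF B(2) that]) blast
  then show ?thesis
    using B topological_basis_open[OF B(2)] unfolding second_countable_def by auto
qed

lemma smooth_manifold_cover:
  fixes q :: "'e::euclidean_space \<Rightarrow> 'm"
  assumes M: "smooth_cover q M" and H: "Hausdorff_space (mtop M)"
    and cov: "\<And>x. \<exists>(U, \<phi>)\<in>matlas M. q x \<in> U"
  shows "smooth_manifold M"
  unfolding smooth_manifold_def
proof (intro conjI H)
  note cont = smooth_coverD(1)[OF M] and op = smooth_coverD(2)[OF M] and surj = smooth_coverD(3)[OF M]
  show "second_countable (mtop M)"
    by (rule second_countable_open_map_image[OF cont op]) (simp_all add: surj second_countable_euclidean)
  show "\<forall>(U, \<phi>)\<in>matlas M. openin (mtop M) U \<and> open (\<phi> ` U) \<and>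
        homeomorphic_map (subtopology (mtop M) U) (top_of_set (\<phi> ` U)) \<phi>"
  proof clarify
    fix U \<phi> assume "(U, \<phi>) \<in> matlas M"
    then obtain W where W: "open W" "U = q ` W" "\<forall>x\<in>W. \<phi> (q x) = x" "\<forall>x\<in>W. inv_into U \<phi> x = q x" "\<phi> ` U = W"
      by (rule smooth_cover_chart[OF M])
    have oq: "openin (mtop M) (q ` S)" if "open S" for S
      using op that by (simp add: open_map_def)
    \<comment> \<open>The preimage of \<open>S\<close> under the local inverse \<open>\<phi>\<close>
      is the image of \<open>W \<inter> S\<close> under \<open>q\<close>, so continuity of
      \<open>\<phi>\<close> is openness of \<open>q\<close>.\<close>
    have "continuous_map (subtopology (mtop M) U) (top_of_set W) \<phi>"
    proof (rule continuous_map_into_subtopology)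
      show "continuous_map (subtopology (mtop M) U) euclidean \<phi>"
        unfolding continuous_map_def
      proof (intro conjI allI impI)
        fix S :: "'e set" assume "openin euclidean S"
        then have "openin (mtop M) (q ` (W \<inter> S))"
          using W(1) by (intro oq) auto
        moreover have "{x \<in> topspace (subtopology (mtop M) U). \<phi> x \<in> S} = q ` (W \<inter> S)"
          using W(2,3) surj by auto
        ultimately show "openin (subtopology (mtop M) U) {x \<in> topspace (subtopology (mtop M) U). \<phi> x \<in> S}"
          using W(2) by (auto simp: openin_subtopology)
      qed auto
    qed (use W in auto)
    moreover have "continuous_map (top_of_set W) (subtopology (mtop M) U) q"
      using cont W(2) by (intro continuous_map_into_subtopology continuous_map_from_subtopology) auto
    ultimately have "homeomorphic_maps (subtopology (mtop M) U) (top_of_set W) \<phi> q"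
      using W(2,3) by (auto simp: homeomorphic_maps_def)
    then show "openin (mtop M) U \<and> open (\<phi> ` U) \<and>
        homeomorphic_map (subtopology (mtop M) U) (top_of_set (\<phi> ` U)) \<phi>"
      using W(1,2,5) oq by (simp add: homeomorphic_maps_map)
  qed
  show "(\<Union>(U, \<phi>)\<in>matlas M. U) = points M"
  proof
    have "U \<subseteq> points M" if "(U, \<phi>) \<in> matlas M" for U \<phi>
      using smooth_coverD(4)[OF M that] surj by blast
    then show "(\<Union>(U, \<phi>)\<in>matlas M. U) \<subseteq> points M"
      by blast
    show "points M \<subseteq> (\<Union>(U, \<phi>)\<in>matlas M. U)"
    proof
      fix y assume "y \<in> points M"
      then obtain x where "y = q x" using surj by blast
      then show "y \<in> (\<Union>(U, \<phi>)\<in>matlas M. U)"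
        using cov[of x] by (simp add: split_def)
    qed
  qed
  show "\<forall>(U, \<phi>)\<in>matlas M. \<forall>(V, \<psi>)\<in>matlas M. smooth_on (\<psi> \<circ> inv_into U \<phi>) (\<phi> ` (U \<inter> V))"
  proof clarify
    fix U \<phi> V \<psi> assume "(U, \<phi>) \<in> matlas M" "(V, \<psi>) \<in> matlas M"
    \<comment> \<open>A change of charts is the coordinate expression of the identity map, which
      lifts to the identity.\<close>
    from smooth_cover_transition[OF M M this, of id id]
    show "smooth_on (\<psi> \<circ> inv_into U \<phi>) (\<phi> ` (U \<inter> V))"
      by (simp add: smooth_on_bounded_linear bounded_linear_ident id_def comp_def)
  qed
qed

lemma smooth_cover_euclidean: "smooth_cover id euclidean_manifold"
proof -
  have "\<exists>d. smooth_on d UNIV \<and> d x = y \<and> (\<forall>z. id (d z) = id z)" if "id x = id y" for x y :: 'a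
    using that smooth_on_bounded_linear[OF bounded_linear_ident open_UNIV]
    by (intro exI[of _ "\<lambda>z. z"]) simp
  then show ?thesis
    unfolding smooth_cover_def euclidean_manifold_def open_map_def
    by (simp add: continuous_on_id exI[of _ UNIV])
qed

lemma smooth_cover_product:
  fixes q :: "'a::euclidean_space \<Rightarrow> 'm" and q' :: "'b::euclidean_space \<Rightarrow> 'n"
  assumes M: "smooth_cover q M" and N: "smooth_cover q' N"
  shows "smooth_cover (map_prod q q') (product_manifold M N)"
  unfolding smooth_cover_def
proof (intro conjI)
  let ?q = "map_prod q q'"
  have [simp]: "mtop (product_manifold M N) = prod_topology (mtop M) (mtop N)"
    by (simp add: product_manifold_def)
  have "continuous_map euclidean (mtop M) (fst \<circ> ?q)"
    using continuous_map_compose[OF _ smooth_coverD(1)[OF M], of euclidean fst]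
    by (simp add: continuous_on_fst fst_comp_map_prod)
  moreover have "continuous_map euclidean (mtop N) (snd \<circ> ?q)"
    using continuous_map_compose[OF _ smooth_coverD(1)[OF N], of euclidean snd]
    by (simp add: continuous_on_snd snd_comp_map_prod)
  ultimately show "continuous_map euclidean (mtop (product_manifold M N)) ?q"
    by (simp add: continuous_map_pairwise)
  show "open_map euclidean (mtop (product_manifold M N)) ?q"
    unfolding open_map_def
  proof (intro allI impI)
    fix S :: "('a \<times> 'b) set" assume S: "openin euclidean S"
    show "openin (mtop (product_manifold M N)) (?q ` S)"
      unfolding \<open>mtop (product_manifold M N) = _\<close> openin_prod_topology_alt
    proof (intro allI impI)
      fix x y assume "(x, y) \<in> ?q ` S"
      then obtain a b where ab: "(a, b) \<in> S" "x = q a" "y = q' b" by auto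
      obtain A B where AB: "open A" "open B" "a \<in> A" "b \<in> B" "A \<times> B \<subseteq> S"
        using S ab(1) by (auto elim: open_prod_elim)
      have "q ` A \<times> q' ` B \<subseteq> ?q ` S"
        using image_mono[OF AB(5), of ?q] by (simp add: map_prod_surj_on)
      then show "\<exists>U V. openin (mtop M) U \<and> openin (mtop N) V \<and> x \<in> U \<and> y \<in> V \<and> U \<times> V \<subseteq> ?q ` S"
        using AB ab smooth_coverD(2)[OF M] smooth_coverD(2)[OF N]
        by (intro exI[of _ "q ` A"] exI[of _ "q' ` B"]) (auto simp: open_map_def)
    qed
  qed
  show "range ?q = points (product_manifold M N)"
    using smooth_coverD(3)[OF M] smooth_coverD(3)[OF N]
    by (metis \<open>mtop (product_manifold M N) = _\<close> topspace_prod_topology map_prod_surj_on UNIV_Times_UNIV)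
  show "\<forall>(U, \<phi>)\<in>matlas (product_manifold M N).
      \<exists>W. open W \<and> U = ?q ` W \<and> (\<forall>x\<in>W. \<phi> (?q x) = x)"
  proof clarify
    fix U \<phi> assume "(U, \<phi>) \<in> matlas (product_manifold M N)"
    then obtain A \<alpha> B \<beta> where AB: "U = A \<times> B" "\<phi> = map_prod \<alpha> \<beta>"
      and A: "(A, \<alpha>) \<in> matlas M" and B: "(B, \<beta>) \<in> matlas N"
      by (auto simp: product_manifold_def)
    obtain X where X: "open X" "A = q ` X" "\<forall>x\<in>X. \<alpha> (q x) = x"
      using smooth_coverD(4)[OF M A] by blast
    obtain Y where Y: "open Y" "B = q' ` Y" "\<forall>y\<in>Y. \<beta> (q' y) = y"
      using smooth_coverD(4)[OF N B] by blast
    show "\<exists>W. open W \<and> U = ?q ` W \<and> (\<forall>x\<in>W. \<phi> (?q x) = x)"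
      using X Y AB by (intro exI[of _ "X \<times> Y"]) (auto simp: open_Times)
  qed
  show "\<forall>x y. ?q x = ?q y \<longrightarrow> (\<exists>d. smooth_on d UNIV \<and> d x = y \<and> (\<forall>z. ?q (d z) = ?q z))"
  proof clarify
    fix a b c e assume "?q (a, b) = ?q (c, e)"
    then have "q a = q c" "q' b = q' e" by auto
    obtain d where d: "smooth_on d UNIV" "d a = c" "\<And>z. q (d z) = q z"
      using smooth_coverD(5)[OF M \<open>q a = q c\<close>] by blast
    obtain d' where d': "smooth_on d' UNIV" "d' b = e" "\<And>z. q' (d' z) = q' z"
      using smooth_coverD(5)[OF N \<open>q' b = q' e\<close>] by blast
    have "smooth_on (\<lambda>z. d (fst z)) UNIV" "smooth_on (\<lambda>z. d' (snd z)) UNIV"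
      by (rule smooth_on_compose[OF open_UNIV open_UNIV _ d(1)] smooth_on_compose[OF open_UNIV open_UNIV _ d'(1)];
          simp add: smooth_on_bounded_linear bounded_linear_fst bounded_linear_snd)+
    then have "smooth_on (\<lambda>z. (d (fst z), d' (snd z))) UNIV"
      by (rule smooth_on_Pair[OF open_UNIV])
    then show "\<exists>d. smooth_on d UNIV \<and> d (a, b) = (c, e) \<and> (\<forall>z. ?q (d z) = ?q z)"
      using d d' by (intro exI[of _ "\<lambda>z. (d (fst z), d' (snd z))"]) (auto simp: map_prod_def)
  qed
qed

section \<open>Orbit spaces of smooth group actions\<close>

text \<open>\<open>group_action\<close> asks for a homomorphism into the group of bijections;
  bijectivity is derived from the two action laws, with the action of the inverse element as inverse
  map.\<close>

lemma group_action_UNIV_I: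
  fixes G (structure)
  assumes "group G" "\<And>x. \<phi> \<one> x = x"
    and hom: "\<And>g h x. g \<in> carrier G \<Longrightarrow> h \<in> carrier G \<Longrightarrow> \<phi> (g \<otimes> h) x = \<phi> g (\<phi> h x)"
  shows "group_action G UNIV \<phi>"
proof -
  interpret group G by fact
  have "bij (\<phi> g)" if "g \<in> carrier G" for g
    by (rule bij_betw_byWitness[where f' = "\<phi> (inv g)"])
      (use that hom[symmetric] assms(2) in auto)
  then have bij: "\<phi> g \<in> Bij UNIV" if "g \<in> carrier G" for g
    using that by (simp add: Bij_def)
  then have "\<phi> \<in> hom G (BijGroup UNIV)"
    using hom by (auto simp: Group.hom_def BijGroup_def compose_def)
  then show ?thesis
    by (simp add: group_action_def group_hom_def group_hom_axioms_def group_BijGroup is_group)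
qed

lemma group_action_orbit_eq_iff:
  assumes "group_action G UNIV \<phi>"
  shows "orbit G \<phi> x = orbit G \<phi> y \<longleftrightarrow> (\<exists>g\<in>carrier G. \<phi> g x = y)"
proof -
  interpret group_action G UNIV \<phi> by fact
  have "orbit G \<phi> x = orbit G \<phi> y \<longleftrightarrow> y \<in> orbit G \<phi> x"
    using orbit_refl orbit_sym orbit_trans by blast
  then show ?thesis by (auto simp: orbit_def)
qed

lemma topspace_quotient_topology: "topspace (quotient_topology G \<phi>) = range (orbit G \<phi>)"
proof -
  have "openin (quotient_topology G \<phi>) (range (orbit G \<phi>))"
    by (auto simp: openin_quotient_topology orbits_def)
  moreover have "topspace (quotient_topology G \<phi>) \<subseteq> range (orbit G \<phi>)"
    using openin_topspace[of "quotient_topology G \<phi>"]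
    unfolding openin_quotient_topology orbits_def by auto
  ultimately show ?thesis
    using openin_subset by blast
qed

text \<open>The deck transformations are the maps \<open>\<phi> g\<close> themselves. Whether the
  charts cover the quotient is a separate matter, settled in
  \<open>smooth_manifold_quotient\<close>.\<close>

lemma smooth_cover_quotient:
  fixes \<phi> :: "'a \<Rightarrow> 'b::euclidean_space \<Rightarrow> 'b"
  assumes act: "group_action G UNIV \<phi>" and sm: "\<And>g. g \<in> carrier G \<Longrightarrow> smooth_on (\<phi> g) UNIV"
  shows "smooth_cover (orbit G \<phi>) (quotient_manifold G \<phi>)"
  unfolding smooth_cover_def
proof (intro conjI)
  note eq = group_action_orbit_eq_iff[OF act]
  have [simp]: "mtop (quotient_manifold G \<phi>) = quotient_topology G \<phi>"
    by (simp add: quotient_manifold_def)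
  show "continuous_map euclidean (mtop (quotient_manifold G \<phi>)) (orbit G \<phi>)"
    by (auto simp: continuous_map_def topspace_quotient_topology openin_quotient_topology)
  show "open_map euclidean (mtop (quotient_manifold G \<phi>)) (orbit G \<phi>)"
    unfolding open_map_def
  proof (intro allI impI)
    fix S :: "'b set" assume "openin euclidean S"
    \<comment> \<open>The saturation of \<open>S\<close> is a union of preimages of \<open>S\<close>
      under group elements, hence open.\<close>
    have "{x. orbit G \<phi> x \<in> orbit G \<phi> ` S} = (\<Union>g\<in>carrier G. \<phi> g -` S)"
      by (auto simp: image_iff eq)
    moreover have "open (\<phi> g -` S)" if "g \<in> carrier G" for g
      using \<open>openin euclidean S\<close> smooth_on_imp_continuous_on[OF sm[OF that]] by (simp add: open_vimage)
    ultimately have "open {x. orbit G \<phi> x \<in> orbit G \<phi> ` S}"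
      by auto
    then show "openin (mtop (quotient_manifold G \<phi>)) (orbit G \<phi> ` S)"
      by (auto simp: openin_quotient_topology orbits_def)
  qed
  show "range (orbit G \<phi>) = points (quotient_manifold G \<phi>)"
    by (simp add: topspace_quotient_topology)
  show "\<forall>(U, \<psi>)\<in>matlas (quotient_manifold G \<phi>).
      \<exists>W. open W \<and> U = orbit G \<phi> ` W \<and> (\<forall>x\<in>W. \<psi> (orbit G \<phi> x) = x)"
    by (auto simp: quotient_manifold_def inv_into_f_f)
  show "\<forall>x y. orbit G \<phi> x = orbit G \<phi> y \<longrightarrow>
      (\<exists>d. smooth_on d UNIV \<and> d x = y \<and> (\<forall>z. orbit G \<phi> (d z) = orbit G \<phi> z))"
  proof (intro allI impI)
    fix x y assume "orbit G \<phi> x = orbit G \<phi> y"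
    then obtain g where g: "g \<in> carrier G" "\<phi> g x = y"
      using eq by blast
    moreover have "orbit G \<phi> (\<phi> g z) = orbit G \<phi> z" for z
      using eq[of z "\<phi> g z"] g(1) by blast
    ultimately show "\<exists>d. smooth_on d UNIV \<and> d x = y \<and> (\<forall>z. orbit G \<phi> (d z) = orbit G \<phi> z)"
      using sm by blast
  qed
qed

text \<open>Lets the whole torus serve as the open set of a trivialization: the restricted manifolds
  in the definition of a line bundle are then literally the original ones.\<close>

lemma open_submanifold_quotient:
  "open_submanifold (quotient_manifold G \<phi>) (points (quotient_manifold G \<phi>)) = quotient_manifold G \<phi>"
proof -
  let ?M = "quotient_manifold G \<phi>"
  have "U \<inter> points ?M = U" if "(U, \<psi>) \<in> matlas ?M" for U \<psi>
    using that by (auto simp: quotient_manifold_def topspace_quotient_topology)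
  then have "{(U \<inter> points ?M, \<psi>) | U \<psi>. (U, \<psi>) \<in> matlas ?M} = matlas ?M"
    by force
  then show ?thesis
    by (simp add: open_submanifold_def)
qed

lemma smooth_manifold_quotient:
  assumes "smooth_cover (orbit G \<phi>) (quotient_manifold G \<phi>)"
    and "Hausdorff_space (quotient_topology G \<phi>)"
    and "\<And>x. \<exists>W. open W \<and> x \<in> W \<and> inj_on (orbit G \<phi>) W"
  shows "smooth_manifold (quotient_manifold G \<phi>)"
proof (rule smooth_manifold_cover[OF assms(1)])
  show "\<exists>(U, \<psi>)\<in>matlas (quotient_manifold G \<phi>). orbit G \<phi> x \<in> U" for x
  proof -
    obtain W where "open W" "x \<in> W" "inj_on (orbit G \<phi>) W"
      using assms(3) by blast
    then show ?thesis
      by (intro bexI[of _ "(orbit G \<phi> ` W, inv_into W (orbit G \<phi>))"])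
        (auto simp: quotient_manifold_def)
  qed
qed (use assms(2) in \<open>simp add: quotient_manifold_def\<close>)

section \<open>Lattices\<close>

lemma is_lattice_group:
  assumes "is_lattice \<Lambda>"
  shows "0 \<in> \<Lambda>" "x \<in> \<Lambda> \<Longrightarrow> y \<in> \<Lambda> \<Longrightarrow> x + y \<in> \<Lambda>" "x \<in> \<Lambda> \<Longrightarrow> - x \<in> \<Lambda>"
proof -
  obtain B where L: "\<Lambda> = range (\<lambda>n :: 'a \<Rightarrow> int. \<Sum>b\<in>B. of_int (n b) *\<^sub>R b)"
    using assms unfolding is_lattice_def by blast
  show "0 \<in> \<Lambda>"
    unfolding L by (intro range_eqI[of _ _ "\<lambda>_. 0"]) simp
  show "x + y \<in> \<Lambda>" if xy: "x \<in> \<Lambda>" "y \<in> \<Lambda>"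
  proof -
    obtain n m :: "'a \<Rightarrow> int" where "x = (\<Sum>b\<in>B. of_int (n b) *\<^sub>R b)" "y = (\<Sum>b\<in>B. of_int (m b) *\<^sub>R b)"
      using xy unfolding L by blast
    then show ?thesis
      unfolding L by (intro range_eqI[of _ _ "\<lambda>b. n b + m b"]) (simp add: scaleR_add_left sum.distrib)
  qed
  show "- x \<in> \<Lambda>" if x: "x \<in> \<Lambda>"
  proof -
    obtain n :: "'a \<Rightarrow> int" where "x = (\<Sum>b\<in>B. of_int (n b) *\<^sub>R b)"
      using x unfolding L by blast
    then show ?thesis
      unfolding L by (intro range_eqI[of _ _ "\<lambda>b. - n b"]) (simp add: sum_negf)
  qed
qed

text \<open>Lattice vectors have integer coordinates in the basis \<open>B\<close>, and coordinates
  are continuous. Near 0 all of them lie strictly between -1 and 1, so they vanish.\<close>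

lemma is_lattice_discrete:
  fixes \<Lambda> :: "'v::euclidean_space set"
  assumes "is_lattice \<Lambda>"
  obtains e where "e > 0" "\<And>l. l \<in> \<Lambda> \<Longrightarrow> norm l < e \<Longrightarrow> l = 0"
proof -
  obtain B :: "'v set" where B: "independent B" "span B = UNIV"
    and L: "\<Lambda> = range (\<lambda>n :: 'v \<Rightarrow> int. \<Sum>b\<in>B. of_int (n b) *\<^sub>R b)"
    using assms unfolding is_lattice_def by blast
  have fin: "finite B"
    using B(1) by (rule independent_imp_finite)
  define S where "S = (\<Inter>b\<in>B. (\<lambda>v. representation B v b) -` {-1<..<1})"
  have "open S"
    unfolding S_def using fin bounded_linear_representation[OF B]
    by (intro open_INT open_vimage ballI) (auto intro: linear_continuous_on)
  moreover have "0 \<in> S"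
    by (simp add: S_def representation_zero)
  ultimately obtain e where e: "e > 0" "ball 0 e \<subseteq> S"
    using open_contains_ball by blast
  have "l = 0" if l: "l \<in> \<Lambda>" "norm l < e" for l
  proof -
    obtain n where n: "l = (\<Sum>b\<in>B. of_int (n b) *\<^sub>R b)"
      using l(1) unfolding L by blast
    have "n b = 0" if b: "b \<in> B" for b
    proof -
      have "representation B l b = (\<Sum>a\<in>B. of_int (n a) * representation B a b)"
        unfolding n using B by (simp add: representation_sum representation_scale)
      also have "\<dots> = (\<Sum>a\<in>B. if a = b then of_int (n a) else 0)"
        using B(1) by (intro sum.cong) (auto simp: representation_basis)
      also have "\<dots> = of_int (n b)"
        using fin b by simp
      finally have "representation B l b = of_int (n b)" .
      moreover have "l \<in> S"
        using e(2) l(2) by auto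
      ultimately have "- 1 < real_of_int (n b)" "real_of_int (n b) < 1"
        using b by (auto simp: S_def)
      then show ?thesis by linarith
    qed
    then show ?thesis
      by (simp add: n)
  qed
  with e(1) show ?thesis
    by (rule that)
qed

text \<open>Differences of lattice vectors are lattice vectors, so the isolation radius at 0
  separates all points of \<Lambda> uniformly.\<close>

lemma is_lattice_closed:
  fixes \<Lambda> :: "'v::euclidean_space set"
  assumes "is_lattice \<Lambda>"
  shows "closed \<Lambda>"
proof -
  obtain e where e: "e > 0" "\<And>l. l \<in> \<Lambda> \<Longrightarrow> norm l < e \<Longrightarrow> l = 0"
    by (rule is_lattice_discrete[OF assms]) blast
  have "y = x" if "x \<in> \<Lambda>" "y \<in> \<Lambda>" "dist y x < e" for x y
    using e(2)[of "y - x"] is_lattice_group(2)[OF assms that(2) is_lattice_group(3)[OF assms that(1)]] that(3)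
    by (simp add: dist_norm)
  then show ?thesis
    by (intro discrete_imp_closed[OF e(1)]) blast
qed

lemma lattice_group_simps [simp]:
  "carrier (lattice_group \<Lambda>) = \<Lambda>" "x \<otimes>\<^bsub>lattice_group \<Lambda>\<^esub> y = x + y" "\<one>\<^bsub>lattice_group \<Lambda>\<^esub> = 0"
  by (simp_all add: lattice_group_def)

lemma group_lattice_group:
  assumes "is_lattice \<Lambda>"
  shows "group (lattice_group \<Lambda>)"
proof (rule groupI)
  show "\<exists>y\<in>carrier (lattice_group \<Lambda>). y \<otimes>\<^bsub>lattice_group \<Lambda>\<^esub> x = \<one>\<^bsub>lattice_group \<Lambda>\<^esub>"
    if "x \<in> carrier (lattice_group \<Lambda>)" for x
    using is_lattice_group(3)[OF assms] that by (intro bexI[of _ "- x"]) auto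
qed (use is_lattice_group[OF assms] in \<open>auto simp: add.assoc\<close>)

lemma cring_complex_field: "cring complex_field"
proof (rule cringI)
  show "abelian_group complex_field"
    by (rule abelian_groupI) (auto simp: complex_field_def intro: exI[of _ "- _"])
  show "comm_monoid complex_field"
    by (rule comm_monoidI) (auto simp: complex_field_def)
qed (simp add: complex_field_def distrib_right)

section \<open>The line bundle\<close>

text \<open>The interface between polarization and construction: a symmetric bilinear form, whose
  quadratic form is the exponent of \<open>weight\<close>, and a multiplier equal to 1 on the
  vectors 2il. The hermitian form reappears only at the instantiation.\<close>

locale line_bundle_data =
  fixes \<Lambda> :: "(real ^ 'g) set" and B :: "real ^ 'g \<Rightarrow> real ^ 'g \<Rightarrow> real" and \<alpha> :: "complex ^ 'g \<Rightarrow> complex"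
  assumes lattice: "is_lattice \<Lambda>"
    and B_sym: "B v w = B w v"
    and B_linear: "linear (\<lambda>v. B v w)"
    and \<alpha>_eq_1: "l \<in> \<Lambda> \<Longrightarrow> \<alpha> ((2 * \<i>) *s cvec l) = 1"
begin

abbreviation qT :: "real ^ 'g \<Rightarrow> (real ^ 'g) set" where
  "qT \<equiv> orbit (lattice_group \<Lambda>) translation"

abbreviation qL :: "(real ^ 'g) \<times> complex \<Rightarrow> ((real ^ 'g) \<times> complex) set" where
  "qL \<equiv> orbit (lattice_group \<Lambda>) (bundle_action B \<alpha>)"

abbreviation T :: "((real ^ 'g) set, real ^ 'g) manifold_data" where
  "T \<equiv> real_torus \<Lambda>"

abbreviation L :: "(((real ^ 'g) \<times> complex) set, (real ^ 'g) \<times> complex) manifold_data" where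
  "L \<equiv> total_space \<Lambda> B \<alpha>"

definition weight :: "real ^ 'g \<Rightarrow> real" where
  "weight v = exp (pi * B v v)"

definition straighten :: "(real ^ 'g) \<times> complex \<Rightarrow> (real ^ 'g) \<times> complex" where
  "straighten x = (fst x, inverse (weight (fst x)) *\<^sub>R snd x)"

definition unstraighten :: "(real ^ 'g) \<times> complex \<Rightarrow> (real ^ 'g) \<times> complex" where
  "unstraighten x = (fst x, weight (fst x) *\<^sub>R snd x)"

text \<open>The orbit of \<open>(v, \<eta>)\<close> for \<open>b = v + \<Lambda>\<close>, where \<open>z\<close> is the second component of \<open>straighten (v, \<eta>)\<close>.\<close>

definition flat_orbit :: "(real ^ 'g) set \<Rightarrow> complex \<Rightarrow> ((real ^ 'g) \<times> complex) set" where
  "flat_orbit b z = (\<lambda>v. unstraighten (v, z)) ` b"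

lemma weight_nonzero: "weight v \<noteq> 0"
  by (simp add: weight_def)

lemma fst_straighten [simp]: "fst (straighten x) = fst x"
  by (simp add: straighten_def)

lemma fst_unstraighten [simp]: "fst (unstraighten x) = fst x"
  by (simp add: unstraighten_def)

lemma unstraighten_straighten [simp]: "unstraighten (straighten x) = x"
  by (simp add: straighten_def unstraighten_def weight_nonzero)

lemma unstraighten_snd_straighten [simp]: "unstraighten (fst x, snd (straighten x)) = x"
  by (metis fst_straighten prod.collapse unstraighten_straighten)

lemma straighten_unstraighten [simp]: "straighten (unstraighten x) = x"
  by (simp add: straighten_def unstraighten_def weight_nonzero)

lemma B_add_left: "B (v + w) u = B v u + B w u"
  by (rule linear_add[OF B_linear])

lemma B_add_right: "B u (v + w) = B u v + B u w"
  by (metis B_sym B_add_left)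

text \<open>\<open>I_factor\<close> is a coboundary: \<open>B(l, l) + 2 B(v, l) = B(v + l, v + l) - B(v, v)\<close>.\<close>

lemma I_factor_eq:
  assumes "l \<in> \<Lambda>"
  shows "I_factor B \<alpha> l v = of_real (weight (v + l) * inverse (weight v))"
proof -
  have "pi * B l l + 2 * pi * B v l = pi * B (v + l) (v + l) + - (pi * B v v)"
    using B_sym[of l v] by (simp add: B_add_left B_add_right algebra_simps)
  then have "exp (pi * B l l + 2 * pi * B v l) = weight (v + l) * inverse (weight v)"
    by (simp only: weight_def exp_add exp_minus)
  then show ?thesis
    by (simp add: I_factor_def \<alpha>_eq_1[OF assms])
qed

lemma bundle_action_eq:
  assumes "l \<in> \<Lambda>"
  shows "bundle_action B \<alpha> l x = unstraighten (fst x + l, snd (straighten x))"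
  by (cases x) (simp add: bundle_action_def I_factor_eq[OF assms] straighten_def unstraighten_def
      scaleR_conv_of_real)

text \<open>Expanding one argument in the basis turns the quadratic form into a finite sum of
  products of two linear functions of \<open>v\<close>.\<close>

lemma smooth_weight_exponent: "smooth_on (\<lambda>v. B v v) UNIV"
proof -
  have "B v v = (\<Sum>b\<in>Basis. (v \<bullet> b) * B v b)" for v
  proof -
    have lin: "linear (\<lambda>u. B v u)"
      using B_linear[of v] by (simp add: B_sym[of v])
    have "B v v = B v (\<Sum>b\<in>Basis. (v \<bullet> b) *\<^sub>R b)"
      by (simp add: euclidean_representation)
    also have "\<dots> = (\<Sum>b\<in>Basis. (v \<bullet> b) * B v b)"
      by (simp add: linear_sum[OF lin] linear_cmul[OF lin])
    finally show ?thesis .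
  qed
  moreover have "Ck_on k (\<lambda>v. \<Sum>b\<in>Basis. (v \<bullet> b) * B v b) UNIV" for k
    using B_linear
    by (intro Ck_on_sum[OF open_UNIV] Ck_on_bounded_bilinear[OF bounded_bilinear_mult open_UNIV]
        Ck_on_bounded_linear[OF _ open_UNIV] bounded_linear_inner_left)
      (simp add: linear_conv_bounded_linear)
  ultimately show ?thesis
    by (simp add: smooth_on_def)
qed

text \<open>The parameter \<open>c\<close> serves both signs: \<open>pi\<close> for
  \<open>weight\<close> and \<open>- pi\<close> for its inverse.\<close>

lemma smooth_exp_fst:
  "smooth_on (\<lambda>x :: (real ^ 'g) \<times> complex. exp (c * B (fst x) (fst x))) UNIV"
proof -
  have "smooth_on (\<lambda>x :: (real ^ 'g) \<times> complex. B (fst x) (fst x)) UNIV"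
    by (rule smooth_on_compose[OF open_UNIV open_UNIV _ smooth_weight_exponent])
      (simp_all add: smooth_on_bounded_linear bounded_linear_fst)
  then show ?thesis
    by (intro smooth_on_exp open_UNIV smooth_on_bounded_bilinear[OF bounded_bilinear_mult] smooth_on_const)
qed

lemma smooth_straighten: "smooth_on straighten UNIV"
proof -
  have "straighten = (\<lambda>x. (fst x, exp (- pi * B (fst x) (fst x)) *\<^sub>R snd x))"
    by (simp add: fun_eq_iff straighten_def weight_def exp_minus)
  then show ?thesis
    by (simp only:, intro smooth_on_Pair smooth_on_bounded_bilinear[OF bounded_bilinear_scaleR]
        smooth_exp_fst smooth_on_bounded_linear bounded_linear_fst bounded_linear_snd open_UNIV)
qed

lemma smooth_unstraighten: "smooth_on unstraighten UNIV"
proof -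
  have "unstraighten = (\<lambda>x. (fst x, exp (pi * B (fst x) (fst x)) *\<^sub>R snd x))"
    by (simp add: fun_eq_iff unstraighten_def weight_def)
  then show ?thesis
    by (simp only:, intro smooth_on_Pair smooth_on_bounded_bilinear[OF bounded_bilinear_scaleR]
        smooth_exp_fst smooth_on_bounded_linear bounded_linear_fst bounded_linear_snd open_UNIV)
qed

lemma smooth_bundle_action:
  assumes "l \<in> \<Lambda>"
  shows "smooth_on (bundle_action B \<alpha> l) UNIV"
proof -
  have "smooth_on (\<lambda>x. x + (l, 0 :: complex)) UNIV"
    by (intro smooth_on_add open_UNIV smooth_on_const smooth_on_bounded_linear bounded_linear_ident)
  then have "smooth_on (\<lambda>x. straighten x + (l, 0)) UNIV"
    by (rule smooth_on_compose[OF open_UNIV open_UNIV smooth_straighten]) simp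
  then have "smooth_on (\<lambda>x. unstraighten (straighten x + (l, 0))) UNIV"
    by (rule smooth_on_compose[OF open_UNIV open_UNIV _ smooth_unstraighten]) simp
  moreover have "bundle_action B \<alpha> l = (\<lambda>x. unstraighten (straighten x + (l, 0)))"
    by (simp add: fun_eq_iff bundle_action_eq[OF assms] straighten_def)
  ultimately show ?thesis
    by simp
qed

section \<open>The two lattice actions\<close>

lemma action_torus: "group_action (lattice_group \<Lambda>) UNIV translation"
  by (rule group_action_UNIV_I[OF group_lattice_group[OF lattice]])
    (simp_all add: translation_def algebra_simps)

lemma action_bundle: "group_action (lattice_group \<Lambda>) UNIV (bundle_action B \<alpha>)"
proof (rule group_action_UNIV_I[OF group_lattice_group[OF lattice]])
  show "bundle_action B \<alpha> \<one>\<^bsub>lattice_group \<Lambda>\<^esub> x = x" for x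
    by (simp add: bundle_action_eq is_lattice_group(1)[OF lattice])
  show "bundle_action B \<alpha> (g \<otimes>\<^bsub>lattice_group \<Lambda>\<^esub> h) x = bundle_action B \<alpha> g (bundle_action B \<alpha> h x)"
    if "g \<in> carrier (lattice_group \<Lambda>)" "h \<in> carrier (lattice_group \<Lambda>)" for g h x
    using that is_lattice_group(2)[OF lattice]
    by (simp add: bundle_action_eq add_ac)
qed

lemma free_action_bundle: "free_action (lattice_group \<Lambda>) UNIV (bundle_action B \<alpha>)"
proof -
  have "bundle_action B \<alpha> l x = x \<longleftrightarrow> l = 0" if "l \<in> \<Lambda>" for l x
  proof
    show "bundle_action B \<alpha> l x = x \<Longrightarrow> l = 0"
      \<comment> \<open>The first component alone forces \<open>l = 0\<close>, so vectors with
        second component 0 also have a trivial stabilizer.\<close>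
      using arg_cong[of "bundle_action B \<alpha> l x" x fst] by (cases x) (simp add: bundle_action_def)
  qed (use that in \<open>simp add: bundle_action_eq\<close>)
  then have "{l \<in> \<Lambda>. bundle_action B \<alpha> l x = x} = {0}" for x
    using is_lattice_group(1)[OF lattice] by blast
  then have "stabilizer (lattice_group \<Lambda>) (bundle_action B \<alpha>) x = {\<one>\<^bsub>lattice_group \<Lambda>\<^esub>}" for x
    unfolding stabilizer_def lattice_group_simps .
  then show ?thesis
    by (simp add: free_action_def action_bundle)
qed

lemma trivial_automorphism_bundle_action:
  assumes "l \<in> \<Lambda>"
  shows "trivial_line_bundle_automorphism (bundle_action B \<alpha> l)"
proof -
  have sm: "smooth_map euclidean_manifold euclidean_manifold (bundle_action B \<alpha> m)" if "m \<in> \<Lambda>" for m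
    by (rule smooth_map_cover[OF smooth_cover_euclidean smooth_cover_euclidean smooth_bundle_action[OF that]]) simp
  have ml: "- l \<in> \<Lambda>"
    by (rule is_lattice_group(3)[OF lattice assms])
  have "diffeomorphism euclidean_manifold euclidean_manifold (bundle_action B \<alpha> l)"
    unfolding diffeomorphism_def
    by (intro conjI sm[OF assms] exI[of _ "bundle_action B \<alpha> (- l)"] sm[OF ml] ballI)
      (simp_all add: bundle_action_eq[OF assms] bundle_action_eq[OF ml])
  moreover have "I_factor B \<alpha> l v \<noteq> 0" for v
    by (simp add: I_factor_eq[OF assms] weight_nonzero)
  ultimately show ?thesis
    unfolding trivial_line_bundle_automorphism_def
    by (intro conjI exI[of _ "\<lambda>v. v + l"] allI, simp, rule_tac x = "I_factor B \<alpha> l v" in exI)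
      (simp add: bundle_action_def)
qed

section \<open>Orbits and their coordinates\<close>

lemma smooth_cover_torus: "smooth_cover qT T"
  unfolding real_torus_def
proof (rule smooth_cover_quotient[OF action_torus])
  show "smooth_on (translation g) UNIV" for g :: "real ^ 'g"
    unfolding translation_def
    by (intro smooth_on_add open_UNIV smooth_on_const smooth_on_bounded_linear bounded_linear_ident)
qed

lemma smooth_cover_total_space: "smooth_cover qL L"
  unfolding total_space_def
  by (rule smooth_cover_quotient[OF action_bundle]) (simp add: lattice_group_def smooth_bundle_action)

lemma qT_eq_iff: "qT v = qT w \<longleftrightarrow> w - v \<in> \<Lambda>"
  unfolding group_action_orbit_eq_iff[OF action_torus] translation_def
  by (auto intro: bexI[of _ "w - v"])

lemma points_torus: "points T = range qT"
  using smooth_coverD(3)[OF smooth_cover_torus] by simp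

lemma points_total_space: "points L = range qL"
  using smooth_coverD(3)[OF smooth_cover_total_space] by simp

text \<open>Over an empty \<open>b\<close> every \<open>flat_orbit\<close> would be empty, and its
  complex coordinate could not be recovered.\<close>

lemma torus_nonempty: "b \<in> points T \<Longrightarrow> b \<noteq> {}"
  using is_lattice_group(1)[OF lattice] by (auto simp: points_torus orbit_def)

text \<open>The straightened second component is constant along an orbit, so a coset and one complex
  number determine the orbit.\<close>

lemma qL_eq: "qL x = flat_orbit (qT (fst x)) (snd (straighten x))"
proof -
  have "qL x = (\<lambda>l. bundle_action B \<alpha> l x) ` \<Lambda>"
    by (auto simp: orbit_def)
  also have "\<dots> = (\<lambda>l. unstraighten (fst x + l, snd (straighten x))) ` \<Lambda>"
    by (rule image_cong[OF refl bundle_action_eq])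
  also have "\<dots> = flat_orbit ((\<lambda>l. translation l (fst x)) ` \<Lambda>) (snd (straighten x))"
    by (simp add: flat_orbit_def image_image translation_def)
  also have "(\<lambda>l. translation l (fst x)) ` \<Lambda> = qT (fst x)"
    by (auto simp: orbit_def)
  finally show ?thesis .
qed

lemma flat_orbit_eq_qL: "flat_orbit (qT v) z = qL (unstraighten (v, z))"
  by (simp add: qL_eq)

lemma projection_flat_orbit: "bundle_projection (flat_orbit b z) = b"
  by (simp add: bundle_projection_def flat_orbit_def image_image)

lemma mem_flat_orbit: "(v, \<eta>) \<in> flat_orbit b z \<longleftrightarrow> v \<in> b \<and> \<eta> = weight v *\<^sub>R z"
  by (auto simp: flat_orbit_def unstraighten_def)

lemma flat_orbit_inj: "b \<noteq> {} \<Longrightarrow> flat_orbit b z = flat_orbit b z' \<longleftrightarrow> z = z'"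
proof
  assume "b \<noteq> {}" and eq: "flat_orbit b z = flat_orbit b z'"
  then obtain v where "v \<in> b" by blast
  then have "(v, weight v *\<^sub>R z) \<in> flat_orbit b z'"
    unfolding eq[symmetric] by (simp add: mem_flat_orbit)
  then show "z = z'"
    by (simp add: mem_flat_orbit weight_nonzero)
qed simp

lemma flat_orbit_cases:
  assumes "x \<in> points L"
  obtains b z where "b \<in> points T" "x = flat_orbit b z"
proof -
  obtain y where "x = qL y"
    using assms unfolding points_total_space by blast
  then have "x = flat_orbit (qT (fst y)) (snd (straighten y))"
    by (simp add: qL_eq)
  moreover have "qT (fst y) \<in> points T"
    by (simp add: points_torus)
  ultimately show ?thesis
    using that by blast
qed

lemma flat_orbit_mem: "b \<in> points T \<Longrightarrow> flat_orbit b z \<in> points L"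
  by (auto simp: points_total_space points_torus flat_orbit_eq_qL)

text \<open>A point of the total space is a set without a preferred representative, hence the
  choice; over points of the torus it is unique by \<open>flat_orbit_inj\<close>.\<close>

definition flat_coordinate :: "((real ^ 'g) \<times> complex) set \<Rightarrow> complex" where
  "flat_coordinate x = (SOME z. x = flat_orbit (bundle_projection x) z)"

lemma flat_coordinate_flat_orbit:
  assumes "b \<in> points T"
  shows "flat_coordinate (flat_orbit b z) = z"
proof -
  have "b \<noteq> {}"
    using assms by (rule torus_nonempty)
  then show ?thesis
    by (simp add: flat_coordinate_def projection_flat_orbit flat_orbit_inj)
qed

lemma flat_orbit_coordinates:
  assumes "x \<in> points L"
  shows "flat_orbit (bundle_projection x) (flat_coordinate x) = x"
proof -
  obtain b z where "b \<in> points T" "x = flat_orbit b z"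
    using assms by (rule flat_orbit_cases)
  then show ?thesis
    by (simp add: projection_flat_orbit flat_coordinate_flat_orbit)
qed

section \<open>Manifold structure of the torus\<close>

text \<open>Two points of a ball of radius \<open>e / 2\<close> differ by less than
  \<open>e\<close>, so a lattice vector between them is 0.\<close>

lemma qT_locally_injective: "\<exists>W. open W \<and> v \<in> W \<and> inj_on qT W"
proof -
  obtain e where e: "e > 0" "\<And>l. l \<in> \<Lambda> \<Longrightarrow> norm l < e \<Longrightarrow> l = 0"
    by (rule is_lattice_discrete[OF lattice]) blast
  have "x = y" if "dist v x < e / 2" "dist v y < e / 2" "y - x \<in> \<Lambda>" for x y
  proof -
    have "norm (y - x) < e"
      using dist_triangle_half_r[OF that(1,2)] by (simp add: dist_norm norm_minus_commute)
    then show ?thesis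
      using e(2)[OF that(3)] by simp
  qed
  then show ?thesis
    using e(1) by (intro exI[of _ "ball v (e / 2)"]) (auto simp: inj_on_def qT_eq_iff)
qed

lemma smooth_manifold_torus: "smooth_manifold T"
  unfolding real_torus_def
proof (rule smooth_manifold_quotient)
  show "smooth_cover qT (quotient_manifold (lattice_group \<Lambda>) translation)"
    using smooth_cover_torus by (simp add: real_torus_def)
  have op: "openin (quotient_topology (lattice_group \<Lambda>) translation) (qT ` S)" if "open S" for S
    using smooth_coverD(2)[OF smooth_cover_torus] that
    by (simp add: open_map_def real_torus_def quotient_manifold_def)
  show "Hausdorff_space (quotient_topology (lattice_group \<Lambda>) translation)"
    unfolding Hausdorff_space_def topspace_quotient_topology
  proof (intro allI impI, elim conjE rangeE)
    fix x y v w assume "x \<noteq> y" and x: "x = qT v" and y: "y = qT w"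
    \<comment> \<open>Distinct cosets mean that \<open>w - v\<close> avoids the closed set
      \<Lambda>, hence so does a ball of radius \<open>e\<close> around it. Moving \<open>v\<close>
      and \<open>w\<close> by less than \<open>e / 2\<close> each keeps the difference in that ball,
      so the two half-radius balls have disjoint images.\<close>
    then have "w - v \<in> - \<Lambda>"
      by (simp add: qT_eq_iff)
    then obtain e where e: "e > 0" "ball (w - v) e \<subseteq> - \<Lambda>"
      using is_lattice_closed[OF lattice] open_contains_ball[of "- \<Lambda>"] by (auto simp: open_Compl)
    have "disjnt (qT ` ball v (e / 2)) (qT ` ball w (e / 2))"
    proof (rule ccontr)
      assume "\<not> disjnt (qT ` ball v (e / 2)) (qT ` ball w (e / 2))"
      then obtain v' w' where vw: "dist v v' < e / 2" "dist w w' < e / 2" "w' - v' \<in> \<Lambda>"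
        by (auto simp: disjnt_def qT_eq_iff)
      have "dist (w - v) (w' - v') \<le> dist w w' + dist v v'"
        unfolding dist_norm by (rule order_trans[OF _ norm_triangle_ineq4]) (simp add: algebra_simps)
      then have "w' - v' \<in> ball (w - v) e"
        using vw by simp
      then show False
        using e(2) vw(3) by blast
    qed
    then show "\<exists>U V. openin (quotient_topology (lattice_group \<Lambda>) translation) U \<and>
        openin (quotient_topology (lattice_group \<Lambda>) translation) V \<and> x \<in> U \<and> y \<in> V \<and> disjnt U V"
      using op[of "ball v (e / 2)"] op[of "ball w (e / 2)"] e(1) x y
      by (intro exI[of _ "qT ` ball v (e / 2)"] exI[of _ "qT ` ball w (e / 2)"]) auto
  qed
qed (rule qT_locally_injective)

section \<open>Projection and global trivialization\<close>

lemma smooth_map_projection: "smooth_map L T bundle_projection"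
proof (rule smooth_map_cover[OF smooth_cover_total_space smooth_cover_torus])
  show "smooth_on (fst :: (real ^ 'g) \<times> complex \<Rightarrow> real ^ 'g) UNIV"
    by (simp add: smooth_on_bounded_linear bounded_linear_fst)
qed (simp add: qL_eq projection_flat_orbit)

abbreviation T_times_C :: "((real ^ 'g) set \<times> complex, (real ^ 'g) \<times> complex) manifold_data" where
  "T_times_C \<equiv> product_manifold T euclidean_manifold"

lemma qT_mem: "qT v \<in> points T"
  by (simp add: points_torus)

text \<open>With the complex plane covering itself by the identity, the lift of this map is
  \<open>straighten\<close>; the lift of its inverse below is \<open>unstraighten\<close>.\<close>

lemma smooth_map_trivialization:
  "smooth_map L T_times_C (\<lambda>x. (bundle_projection x, flat_coordinate x))"
  by (rule smooth_map_cover[OF smooth_cover_total_space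
        smooth_cover_product[OF smooth_cover_torus smooth_cover_euclidean] smooth_straighten])
    (simp add: qL_eq projection_flat_orbit flat_coordinate_flat_orbit[OF qT_mem] map_prod_def split_def)

lemma smooth_map_flat_orbit: "smooth_map T_times_C L (\<lambda>y. flat_orbit (fst y) (snd y))"
  by (rule smooth_map_cover[OF smooth_cover_product[OF smooth_cover_torus smooth_cover_euclidean]
        smooth_cover_total_space smooth_unstraighten])
    (simp add: flat_orbit_eq_qL map_prod_def split_def)

lemma diffeomorphism_trivialization:
  "diffeomorphism L T_times_C (\<lambda>x. (bundle_projection x, flat_coordinate x))"
  unfolding diffeomorphism_def
proof (intro conjI smooth_map_trivialization exI[of _ "\<lambda>y. flat_orbit (fst y) (snd y)"] smooth_map_flat_orbit ballI)
  show "flat_orbit (fst (bundle_projection x, flat_coordinate x)) (snd (bundle_projection x, flat_coordinate x)) = x"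
    if "x \<in> points L" for x
    using flat_orbit_coordinates[OF that] by simp
  show "(bundle_projection (flat_orbit (fst y) (snd y)), flat_coordinate (flat_orbit (fst y) (snd y))) = y"
    if "y \<in> points T_times_C" for y
    using that by (simp add: projection_flat_orbit flat_coordinate_flat_orbit product_manifold_def mem_Times_iff)
qed

lemma smooth_manifold_total_space: "smooth_manifold L"
  unfolding total_space_def
proof (rule smooth_manifold_quotient)
  show "smooth_cover qL (quotient_manifold (lattice_group \<Lambda>) (bundle_action B \<alpha>))"
    using smooth_cover_total_space by (simp add: total_space_def)
  let ?F = "\<lambda>x. (bundle_projection x, flat_coordinate x)"
  \<comment> \<open>The trivialization is a continuous injection into a Hausdorff space.\<close>
  have "Hausdorff_space (mtop L)"
  proof (rule Hausdorff_space_injective_preimage)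
    show "Hausdorff_space (mtop T_times_C)"
    proof -
      have "Hausdorff_space (mtop T)"
        using smooth_manifold_torus unfolding smooth_manifold_def by (elim conjE)
      then show ?thesis
        by (simp add: product_manifold_def euclidean_manifold_def Hausdorff_space_prod_topology)
    qed
    show "continuous_map (mtop L) (mtop T_times_C) ?F"
      using smooth_map_trivialization unfolding smooth_map_def by (elim conjE)
    show "inj_on ?F (points L)"
    proof (rule inj_onI)
      fix x y assume "x \<in> points L" "y \<in> points L" "?F x = ?F y"
      then show "x = y"
        using flat_orbit_coordinates by (metis prod.inject)
    qed
  qed
  then show "Hausdorff_space (quotient_topology (lattice_group \<Lambda>) (bundle_action B \<alpha>))"
    by (simp add: total_space_def quotient_manifold_def)
  show "\<exists>W. open W \<and> x \<in> W \<and> inj_on qL W" for x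
  proof -
    obtain V where V: "open V" "fst x \<in> V" "inj_on qT V"
      using qT_locally_injective by blast
    \<comment> \<open>Two points over \<open>V\<close> in the same orbit have equal first components
      by the choice of \<open>V\<close>, and the flat coordinate of the orbit fixes the
      second.\<close>
    have "inj_on qL (fst -` V)"
    proof (rule inj_onI)
      fix y z assume yz: "y \<in> fst -` V" "z \<in> fst -` V" "qL y = qL z"
      then have q: "qT (fst y) = qT (fst z)"
        by (metis qL_eq projection_flat_orbit)
      then have 1: "fst y = fst z"
        using inj_onD[OF V(3) q] yz by simp
      have "snd (straighten y) = snd (straighten z)"
        using yz(3) by (simp add: qL_eq q flat_orbit_inj[OF torus_nonempty[OF qT_mem]])
      with 1 have "straighten y = straighten z"
        by (simp add: prod_eq_iff)
      then show "y = z"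
        by (metis unstraighten_straighten)
    qed
    then show ?thesis
      using V(1,2) by (intro exI[of _ "fst -` V"]) (auto intro: open_vimage_fst)
  qed
qed

section \<open>Vector space structure of the fibres\<close>

lemma carrier_fibre: "b \<in> points T \<Longrightarrow> carrier (bundle_fibre \<Lambda> B \<alpha> b) = range (flat_orbit b)"
  by (auto simp: bundle_fibre_def projection_flat_orbit flat_orbit_mem elim: flat_orbit_cases)

text \<open>The value of a flat orbit over \<open>v\<close> is \<open>weight v *\<^sub>R z\<close>,
  which is linear in \<open>z\<close>, so pointwise operations on orbits are operations on
  \<open>z\<close>.\<close>

lemma add_fibre:
  "flat_orbit b z \<oplus>\<^bsub>bundle_fibre \<Lambda> B \<alpha> b\<^esub> flat_orbit b z' = flat_orbit b (z + z')"
  by (auto simp: bundle_fibre_def mem_flat_orbit scaleR_add_right set_eq_iff)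

lemma smult_fibre: "k \<odot>\<^bsub>bundle_fibre \<Lambda> B \<alpha> b\<^esub> flat_orbit b z = flat_orbit b (k * z)"
  by (auto simp: bundle_fibre_def mem_flat_orbit set_eq_iff)

lemma zero_fibre: "\<zero>\<^bsub>bundle_fibre \<Lambda> B \<alpha> b\<^esub> = flat_orbit b 0"
  by (auto simp: bundle_fibre_def mem_flat_orbit)

text \<open>By the three preceding facts \<open>flat_orbit b\<close> carries the operations of the
  complex numbers onto those of the fibre, and the axioms are transported along it.\<close>

lemma module_fibre:
  assumes "b \<in> points T"
  shows "module complex_field (bundle_fibre \<Lambda> B \<alpha> b)"
proof (rule moduleI[OF cring_complex_field])
  note [simp] = carrier_fibre[OF assms] add_fibre smult_fibre zero_fibre
  show "abelian_group (bundle_fibre \<Lambda> B \<alpha> b)"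
  proof (rule abelian_groupI)
    show "\<exists>y\<in>carrier (bundle_fibre \<Lambda> B \<alpha> b). y \<oplus>\<^bsub>bundle_fibre \<Lambda> B \<alpha> b\<^esub> x = \<zero>\<^bsub>bundle_fibre \<Lambda> B \<alpha> b\<^esub>"
      if x: "x \<in> carrier (bundle_fibre \<Lambda> B \<alpha> b)" for x
    proof -
      obtain z where "x = flat_orbit b z"
        using x by auto
      then show ?thesis
        by (intro bexI[of _ "flat_orbit b (- z)"]) auto
    qed
  qed (auto simp: add_ac)
qed (auto simp: carrier_fibre[OF assms] add_fibre smult_fibre complex_field_def algebra_simps)

lemma one_dimensional_fibre:
  assumes "b \<in> points T"
  shows "one_dimensional (bundle_fibre \<Lambda> B \<alpha> b)"
  unfolding one_dimensional_def carrier_fibre[OF assms]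
  using flat_orbit_inj[OF torus_nonempty[OF assms]]
  by (intro bexI[of _ "flat_orbit b 1"]) (auto simp: smult_fibre)

lemma line_bundle: "smooth_complex_line_bundle L T bundle_projection (bundle_fibre \<Lambda> B \<alpha>)"
  unfolding smooth_complex_line_bundle_def
proof (intro conjI ballI)
  show "carrier (bundle_fibre \<Lambda> B \<alpha> b) = {x \<in> points L. bundle_projection x = b}" for b
    by (simp add: bundle_fibre_def)
  fix b assume b: "b \<in> points T"
  \<comment> \<open>The trivializing open set is the whole torus, so its preimage has to be
    recognized as all of \<open>L\<close>.\<close>
  have proj: "{x \<in> points L. bundle_projection x \<in> points T} = points L"
    by (auto simp: projection_flat_orbit elim: flat_orbit_cases)
  have "open_submanifold L (points L) = L" "open_submanifold T (points T) = T"
    by (simp_all only: total_space_def real_torus_def open_submanifold_quotient)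
  then have "diffeomorphism (open_submanifold L {x \<in> points L. bundle_projection x \<in> points T})
      (product_manifold (open_submanifold T (points T)) euclidean_manifold)
      (\<lambda>x. (bundle_projection x, flat_coordinate x))"
    using diffeomorphism_trivialization by (simp only: proj)
  moreover have "flat_coordinate (x \<oplus>\<^bsub>bundle_fibre \<Lambda> B \<alpha> c\<^esub> y) = flat_coordinate x + flat_coordinate y"
    if "c \<in> points T" "x \<in> carrier (bundle_fibre \<Lambda> B \<alpha> c)" "y \<in> carrier (bundle_fibre \<Lambda> B \<alpha> c)" for c x y
    using that by (auto simp: carrier_fibre add_fibre flat_coordinate_flat_orbit)
  moreover have "flat_coordinate (k \<odot>\<^bsub>bundle_fibre \<Lambda> B \<alpha> c\<^esub> x) = k * flat_coordinate x"
    if "c \<in> points T" "x \<in> carrier (bundle_fibre \<Lambda> B \<alpha> c)" for c x k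
    using that by (auto simp: carrier_fibre smult_fibre flat_coordinate_flat_orbit)
  ultimately show "\<exists>U h. openin (mtop T) U \<and> b \<in> U \<and>
      diffeomorphism (open_submanifold L {x \<in> points L. bundle_projection x \<in> U})
        (product_manifold (open_submanifold T U) (euclidean_manifold :: (complex, complex) manifold_data))
        (\<lambda>x. (bundle_projection x, h x)) \<and>
      (\<forall>c\<in>U. \<forall>x\<in>carrier (bundle_fibre \<Lambda> B \<alpha> c). \<forall>y\<in>carrier (bundle_fibre \<Lambda> B \<alpha> c).
        h (x \<oplus>\<^bsub>bundle_fibre \<Lambda> B \<alpha> c\<^esub> y) = h x + h y) \<and>
      (\<forall>c\<in>U. \<forall>x\<in>carrier (bundle_fibre \<Lambda> B \<alpha> c). \<forall>k. h (k \<odot>\<^bsub>bundle_fibre \<Lambda> B \<alpha> c\<^esub> x) = k * h x)"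
    using b by (intro exI[of _ "points T"] exI[of _ flat_coordinate] conjI ballI allI openin_topspace)
qed (simp_all add: smooth_manifold_total_space smooth_manifold_torus smooth_map_projection
    module_fibre one_dimensional_fibre)

end

section \<open>From the hermitian form to the line bundle\<close>

lemma line_bundle_data_polarized:
  fixes \<Lambda> :: "(real ^ 'g) set"
  assumes "polarized_real_torus \<Lambda> H"
  shows "line_bundle_data \<Lambda> (B_form H) (canonical_map H)"
proof (rule line_bundle_data.intro)
  show "is_lattice \<Lambda>"
    using assms unfolding polarized_real_torus_def by (elim conjE)
  have H: "positive_definite_hermitian H"
    using assms unfolding polarized_real_torus_def by (elim conjE)
  have H_add: "H (x + y) z = H x z + H y z" and H_scale: "H (c *s x) y = c * H x y"
    and H_sym: "H y x = cnj (H x y)" for x y z c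
    using H unfolding positive_definite_hermitian_def by blast+
  show "B_form H v w = B_form H w v" for v w
    using H_sym[of "cvec v" "cvec w"] by (simp add: B_form_def)
  show "linear (\<lambda>v. B_form H v w)" for w
  proof (rule linearI)
    have cvec_add: "cvec (x + y) = cvec x + cvec y" for x y :: "real ^ 'g"
      by (simp add: cvec_def vec_eq_iff)
    have cvec_scale: "cvec (c *\<^sub>R x) = of_real c *s cvec x" for c and x :: "real ^ 'g"
      by (simp add: cvec_def vec_eq_iff)
    show "B_form H (x + y) w = B_form H x w + B_form H y w" for x y
      by (simp add: B_form_def cvec_add H_add)
    show "B_form H (c *\<^sub>R x) w = c *\<^sub>R B_form H x w" for c x
      by (simp add: B_form_def cvec_scale H_scale)
  qed
  show "canonical_map H ((2 * \<i>) *s cvec l) = 1" for l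
  proof -
    \<comment> \<open>The vector 2il is purely imaginary. Its zero real part is written
      \<open>0 *s 0\<close> so that homogeneity of \<open>H\<close> in the first argument makes
      \<open>H\<close> vanish, and the exponent in \<open>canonical_map\<close> becomes 0.\<close>
    have "cvec (Re_vec ((2 * \<i>) *s cvec l)) = 0 *s 0"
      by (simp add: cvec_def Re_vec_def vec_eq_iff)
    then have "H (cvec (Re_vec ((2 * \<i>) *s cvec l))) z = 0" for z
      by (simp only: H_scale mult_zero_left)
    then show ?thesis
      by (simp add: canonical_map_def)
  qed
qed

theorem theorem7p1:
  fixes \<Lambda> :: "(real ^ 'g) set"
    and H :: "complex ^ 'g \<Rightarrow> complex ^ 'g \<Rightarrow> complex"
    and B :: "real ^ 'g \<Rightarrow> real ^ 'g \<Rightarrow> real"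
    and \<alpha> :: "complex ^ 'g \<Rightarrow> complex"
  assumes "polarized_real_torus \<Lambda> H"
    and "B = B_form H"
    and "\<alpha> = canonical_map H"
  shows "(\<forall>l\<in>\<Lambda>. \<forall>v. I_factor B \<alpha> l v \<noteq> 0) \<and>
    free_action (lattice_group \<Lambda>) UNIV (bundle_action B \<alpha>) \<and>
    (\<forall>l\<in>\<Lambda>. trivial_line_bundle_automorphism (bundle_action B \<alpha> l)) \<and>
    smooth_complex_line_bundle (total_space \<Lambda> B \<alpha>) (real_torus \<Lambda>)
      bundle_projection (bundle_fibre \<Lambda> B \<alpha>)"
proof -
  interpret line_bundle_data \<Lambda> B \<alpha>
    using line_bundle_data_polarized[OF assms(1)] assms(2,3) by simp
  show ?thesis
    using free_action_bundle trivial_automorphism_bundle_action line_bundle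
    by (simp add: I_factor_eq weight_nonzero)
qed

end
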